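(* For every constant $0\le h_0\le\log 3$, the isentrope $\mathcal I(h_0)=\{\mathbf w\in\overline T : h(S_{\mathbf w})=h_0\}$ of the stunted sawtooth family is compact and connected.
   Context: Let $\overline T=\{(w_1,w_2)\in\mathbb R^2: 1\ge w_1\ge w_2\ge 0\}$. Let $S:[0,1]\to[0,1]$ be the sawtooth map $S(x)=3x$ on $[0,1/3]$, $S(x)=2-3x$ on $[1/3,2/3]$, $S(x)=3x-2$ on $[2/3,1]$. For $\mathbf w=(w_1,w_2)\in\overline T$, the stunted sawtooth map $S_{\mathbf w}$ is defined by $S_{\mathbf w}(x)=\min(3x,w_1)$ for $x\in[0,1/3]$, $S_{\mathbf w}(x)=\min(w_1,\max(w_2,2-3x))$ for $x\in[1/3,2/3]$, and $S_{\mathbf w}(x)=\max(3x-2,w_2)$ for $x\in[2/3,1]$ (i.e. $S$ with its top cut off at height $w_1$ near $1/3$ and its bottom cut off at height $w_2$ near $2/3$). $h$ denotes topological entropy; for piecewise monotone maps $h(f)=\lim_{n\to\infty}\frac1n\log\ell(f^{\circ n})$, $\ell$ = number of laps (maximal intervals of monotonicity). *)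

theory Defs
  imports "HOL-Analysis.Analysis"
begin

definition Tbar :: "(real \<times> real) set" where
  "Tbar = {(w1, w2). 1 \<ge> w1 \<and> w1 \<ge> w2 \<and> w2 \<ge> 0}"

text \<open>Stunted sawtooth map \<open>S_w\<close> (relevant on [0,1]; the formula is just extended outside).\<close>
definition stunted_sawtooth :: "real \<times> real \<Rightarrow> real \<Rightarrow> real" where
  "stunted_sawtooth w x =
     (if x \<le> 1/3 then min (3 * x) (fst w)
      else if x \<le> 2/3 then min (fst w) (max (snd w) (2 - 3 * x))
      else max (3 * x - 2) (snd w))"

definition laps :: "(real \<Rightarrow> real) \<Rightarrow> nat" where
  "laps f = (LEAST k. \<exists>a :: nat \<Rightarrow> real. a 0 = 0 \<and> a k = 1 \<and>
       (\<forall>i<k. a i < a (Suc i)) \<and>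
       (\<forall>i<k. mono_on {a i .. a (Suc i)} f \<or>
              monotone_on {a i .. a (Suc i)} (\<le>) (\<ge>) f))"

definition top_entropy :: "(real \<Rightarrow> real) \<Rightarrow> real" where
  "top_entropy f = lim (\<lambda>n. ln (real (laps (f ^^ n))) / real n)"

definition isentrope :: "real \<Rightarrow> (real \<times> real) set" where
  "isentrope h0 = {w \<in> Tbar. top_entropy (stunted_sawtooth w) = h0}"

end

(* Let v(n) count how often the n-th iterate of S_w crosses the turning points 1/3 and 2/3. Up to
   summing over n, v(n) and the lap numbers bound each other, and v(n) is monotone in w with respect
   to the order in which w1 increases and w2 decreases; hence so is the growth rate s = exp h.

   Continuity of s. If sum v(n) / tau^n diverges, the normalised partial sums converge to an
   increasing function L on [0,1] that S_w expands by at least tau on each lap of S, so all lap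
   numbers satisfy laps(S_w^n) >= tau^n. This argument survives a perturbation of w, which gives upper
   semicontinuity (and the existence of the limit defining h). If lower semicontinuity failed
   at w, then for every tau in some interval the limit L would be expanded exactly by tau. Then the
   kneading determinant, a power series with value 1 at 0, would vanish on an interval.

   On each line w1 + w2 = c the growth rate is monotone, so the isentrope meets these lines in
   segments, for c in an interval; as it is compact, it is connected. *)

theory Submission
  imports Defs "HOL-Complex_Analysis.Complex_Analysis"
begin

text \<open>Crossing counts jump, so v(n) is not continuous in w. Pointwise limits of the normalised
  sums are not enough either: the limit must be evaluated at S_(W k) x, which moves with k. Hence
  the sums are shown to be asymptotically equicontinuous. The jumps do no harm, being divided by
  sums that tend to infinity; the obstacle is a turning point, where one step costs a factor 2 that
  may outweigh the gain t. When lower semicontinuity fails, take \<tau> above the growth rates along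
  the sequence and below that of the limit. Each series then converges, but the sums are unbounded
  along the sequence: the normaliser tends to infinity while the truncation error stays bounded,
  which turns the inequality for L into an equation. This equation determines L linearly from its
  values at w1 and w2; consistency at these two points is a homogeneous 2 by 2 system, whose
  determinant is the kneading determinant. The lines w1 + w2 = c are chains for the order in which
  the growth rate is monotone.\<close>

section \<open>Elementary properties of the stunted maps\<close>

text \<open>A single expression in min and max: joint continuity in w and x and the Lipschitz bound
  then hold termwise, without matching branches.\<close>

lemma stunted_sawtooth_altdef:
  assumes "w \<in> Tbar"
  shows "stunted_sawtooth w x =
    min (3 * x) (max (min (fst w) (2 - 3 * x)) (max (snd w) (3 * x - 2)))"
  using assms by (auto simp: stunted_sawtooth_def Tbar_def min_def max_def)

lemma stunted_sawtooth_tendsto: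
  assumes "w \<in> Tbar" "\<forall>\<^sub>F k in F. W k \<in> Tbar"
    and "(W \<longlongrightarrow> w) F" "(x \<longlongrightarrow> a) F"
  shows "((\<lambda>k. stunted_sawtooth (W k) (x k)) \<longlongrightarrow> stunted_sawtooth w a) F"
proof -
  have "((\<lambda>k. min (3 * x k) (max (min (fst (W k)) (2 - 3 * x k)) (max (snd (W k)) (3 * x k - 2))))
      \<longlongrightarrow> min (3 * a) (max (min (fst w) (2 - 3 * a)) (max (snd w) (3 * a - 2)))) F"
    by (intro tendsto_intros assms)
  then show ?thesis
    unfolding stunted_sawtooth_altdef[OF assms(1)]
    by (rule Lim_transform_eventually) (use assms(2) in eventually_elim, simp add: stunted_sawtooth_altdef)
qed

lemma continuous_on_stunted_sawtooth:
  assumes "w \<in> Tbar"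
  shows "continuous_on A (stunted_sawtooth w)"
  unfolding stunted_sawtooth_altdef[OF assms, abs_def] by (intro continuous_intros)

lemma stunted_sawtooth_range:
  assumes "w \<in> Tbar" "0 \<le> x" "x \<le> 1"
  shows "0 \<le> stunted_sawtooth w x" "stunted_sawtooth w x \<le> 1"
  using assms by (auto simp: stunted_sawtooth_altdef Tbar_def min_def max_def)

lemma funpow_stunted_sawtooth_range:
  assumes "w \<in> Tbar" "0 \<le> x" "x \<le> 1"
  shows "0 \<le> (stunted_sawtooth w ^^ n) x \<and> (stunted_sawtooth w ^^ n) x \<le> 1"
  using assms by (induction n) (auto intro: stunted_sawtooth_range)

lemma continuous_on_funpow_stunted_sawtooth:
  assumes "w \<in> Tbar"
  shows "continuous_on A (stunted_sawtooth w ^^ n)"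
proof -
  have "continuous_on UNIV (stunted_sawtooth w ^^ n)"
  proof (induction n)
    case (Suc n)
    then show ?case
      by (simp add: continuous_on_compose continuous_on_stunted_sawtooth assms del: o_apply)
  qed (simp add: id_def)
  then show ?thesis by (rule continuous_on_subset) simp
qed

lemma stunted_sawtooth_fixed [simp]:
  assumes "w \<in> Tbar"
  shows "stunted_sawtooth w 0 = 0" "stunted_sawtooth w 1 = 1"
    "stunted_sawtooth w (1/3) = fst w" "stunted_sawtooth w (2/3) = snd w"
  using assms by (auto simp: stunted_sawtooth_altdef Tbar_def min_def max_def)

lemma Tbar_bounds:
  assumes "w \<in> Tbar"
  shows "0 \<le> snd w" "snd w \<le> fst w" "fst w \<le> 1" "0 \<le> fst w" "snd w \<le> 1"
  using assms by (auto simp: Tbar_def)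

section \<open>Thirds of the interval and monotone pieces\<close>

text \<open>The laps of the full sawtooth map. They do not depend on w, so maps with different
  parameters can be compared on the same intervals.\<close>

definition third :: "real \<Rightarrow> real \<Rightarrow> bool" where
  "third x y \<longleftrightarrow> x \<le> y \<and> (0 \<le> x \<and> y \<le> 1/3 \<or> 1/3 \<le> x \<and> y \<le> 2/3 \<or> 2/3 \<le> x \<and> y \<le> 1)"

text \<open>Reduces estimates that add up over adjacent intervals to a single third, where
  \<open>stunted_sawtooth w\<close> is monotone.\<close>

lemma third_induct:
  assumes third: "\<And>x y. \<lbrakk>third x y; a \<le> x; y \<le> b\<rbrakk> \<Longrightarrow> P x y"
    and trans: "\<And>x y z. \<lbrakk>a \<le> x; x \<le> y; y \<le> z; z \<le> b; P x y; P y z\<rbrakk> \<Longrightarrow> P x z"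
    and ab: "0 \<le> a" "a \<le> b" "b \<le> 1"
  shows "P a b"
proof -
  \<comment> \<open>The turning points clamped to [a, b]; one that lies outside leaves a degenerate
    piece, which \<open>third\<close> admits.\<close>
  define p where "p = max a (min b (1/3))"
  define q where "q = max a (min b (2/3))"
  have *: "a \<le> p" "p \<le> q" "q \<le> b" using ab by (auto simp: p_def q_def)
  have "P a p" by (rule third) (use ab in \<open>auto simp: third_def p_def\<close>)
  moreover have "P p q" by (rule third) (use ab in \<open>auto simp: third_def p_def q_def\<close>)
  moreover have "P q b" by (rule third) (use ab in \<open>auto simp: third_def p_def q_def\<close>)
  ultimately show ?thesis by (meson * trans order.refl order.trans)
qed

lemma third_01: "third x y \<Longrightarrow> 0 \<le> x \<and> x \<le> y \<and> y \<le> 1"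
  by (auto simp: third_def)

definition bimono :: "(real \<Rightarrow> real) \<Rightarrow> real \<Rightarrow> real \<Rightarrow> bool" where
  "bimono g a b \<longleftrightarrow> mono_on {a..b} g \<or> monotone_on {a..b} (\<le>) (\<ge>) g"

lemma bimono_subset: "bimono g a b \<Longrightarrow> a \<le> x \<Longrightarrow> y \<le> b \<Longrightarrow> bimono g x y"
  unfolding bimono_def monotone_on_def by (meson atLeastAtMost_iff order.trans)

lemma bimono_third:
  assumes "w \<in> Tbar" "third x y"
  shows "bimono (stunted_sawtooth w) x y"
proof -
  have "third x y \<Longrightarrow> y \<le> 1/3 \<Longrightarrow> ?thesis"
    using assms(1) unfolding bimono_def monotone_on_def
    by (auto simp: stunted_sawtooth_altdef Tbar_def third_def min_def max_def)
  moreover have "third x y \<Longrightarrow> 1/3 \<le> x \<Longrightarrow> y \<le> 2/3 \<Longrightarrow> ?thesis"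
    using assms(1) unfolding bimono_def monotone_on_def
    by (intro disjI2) (auto simp: stunted_sawtooth_altdef Tbar_def third_def min_def max_def)
  moreover have "third x y \<Longrightarrow> 2/3 \<le> x \<Longrightarrow> ?thesis"
    using assms(1) unfolding bimono_def monotone_on_def
    by (auto simp: stunted_sawtooth_altdef Tbar_def third_def min_def max_def)
  ultimately show ?thesis using assms(2) unfolding third_def by blast
qed

lemma bimono_comp:
  assumes "bimono h x y" "bimono g (min (h x) (h y)) (max (h x) (h y))"
  shows "bimono (g \<circ> h) x y"
proof -
  let ?J = "{min (h x) (h y)..max (h x) (h y)}"
  have "h u \<in> ?J" if "u \<in> {x..y}" for u
    using assms(1) that unfolding bimono_def monotone_on_def by fastforce
  then have sub: "h ` {x..y} \<subseteq> ?J" by blast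
  have "mono_on (h ` {x..y}) g \<or> monotone_on (h ` {x..y}) (\<le>) (\<ge>) g"
    using assms(2) monotone_on_subset[OF _ sub] unfolding bimono_def by blast
  with assms(1) show ?thesis
    unfolding bimono_def monotone_on_def by (auto 0 3)
qed

text \<open>By the intermediate value theorem h maps [x, y] onto the interval between its end
  values, so values u <= v lift to points in the same or the opposite order. This peels the first
  step off an iterate: if S_w^(n+1) is monotone on an interval inside a third, S_w^n is monotone on
  its image.\<close>

lemma bimono_image:
  assumes cont: "continuous_on {x..y} h" and h: "bimono h x y" and "x \<le> y"
    and gh: "bimono (g \<circ> h) x y"
  shows "bimono g (min (h x) (h y)) (max (h x) (h y))"
proof -
  have ex: "\<exists>p\<in>{x..y}. h p = u" if "u \<in> {min (h x) (h y)..max (h x) (h y)}" for u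
    using that IVT'[of h x u y] IVT2'[of h y u x] cont \<open>x \<le> y\<close>
    by (auto simp: min_def max_def split: if_splits)
  have up: "\<exists>p q. p \<in> {x..y} \<and> q \<in> {x..y} \<and> p \<le> q \<and> h p = u \<and> h q = v"
    if uv: "mono_on {x..y} h" "u \<le> v" "u \<in> {min (h x) (h y)..max (h x) (h y)}"
      "v \<in> {min (h x) (h y)..max (h x) (h y)}" for u v
  proof -
    obtain p where p: "p \<in> {x..y}" "h p = u" using ex[OF uv(3)] by blast
    obtain q where q: "q \<in> {x..y}" "h q = v" using ex[OF uv(4)] by blast
    show ?thesis
    \<comment> \<open>Preimages in the wrong order occur only on a plateau; then u = v and one point
      serves as both.\<close>
    proof (cases "p \<le> q")
      case False
      then have "h q \<le> h p" using that(1) p q unfolding monotone_on_def by auto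
      with p q that(2) have "u = v" by auto
      with p show ?thesis by blast
    qed (use p q in blast)
  qed
  have down: "\<exists>p q. p \<in> {x..y} \<and> q \<in> {x..y} \<and> p \<le> q \<and> h q = u \<and> h p = v"
    if uv: "monotone_on {x..y} (\<le>) (\<ge>) h" "u \<le> v" "u \<in> {min (h x) (h y)..max (h x) (h y)}"
      "v \<in> {min (h x) (h y)..max (h x) (h y)}" for u v
  proof -
    obtain p where p: "p \<in> {x..y}" "h p = u" using ex[OF uv(3)] by blast
    obtain q where q: "q \<in> {x..y}" "h q = v" using ex[OF uv(4)] by blast
    show ?thesis
    proof (cases "q \<le> p")
      case False
      then have "h q \<le> h p" using that(1) p q unfolding monotone_on_def by auto
      with p q that(2) have "u = v" by auto
      with p show ?thesis by blast
    qed (use p q in blast)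
  qed
  have *: "g (h p) \<le> g (h q)" if "mono_on {x..y} (g \<circ> h)" "p \<le> q" "p \<in> {x..y}" "q \<in> {x..y}" for p q
    using that unfolding monotone_on_def by auto
  have **: "g (h p) \<ge> g (h q)" if "monotone_on {x..y} (\<le>) (\<ge>) (g \<circ> h)" "p \<le> q" "p \<in> {x..y}" "q \<in> {x..y}" for p q
    using that unfolding monotone_on_def by auto
  let ?J = "{min (h x) (h y)..max (h x) (h y)}"
  consider (a) "mono_on {x..y} h" "mono_on {x..y} (g \<circ> h)" 
    | (b) "mono_on {x..y} h" "monotone_on {x..y} (\<le>) (\<ge>) (g \<circ> h)"
    | (c) "monotone_on {x..y} (\<le>) (\<ge>) h" "mono_on {x..y} (g \<circ> h)"
    | (d) "monotone_on {x..y} (\<le>) (\<ge>) h" "monotone_on {x..y} (\<le>) (\<ge>) (g \<circ> h)"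
    using h gh unfolding bimono_def by blast
  then show ?thesis
  proof cases
    case a
    have "mono_on ?J g" by (intro monotone_onI) (metis up * a)
    then show ?thesis unfolding bimono_def ..
  next
    case b
    have "monotone_on ?J (\<le>) (\<ge>) g" by (intro monotone_onI) (metis up ** b)
    then show ?thesis unfolding bimono_def ..
  next
    case c
    have "monotone_on ?J (\<le>) (\<ge>) g" by (intro monotone_onI) (metis down * c)
    then show ?thesis unfolding bimono_def ..
  next
    case d
    have "mono_on ?J g" by (intro monotone_onI) (metis down ** d)
    then show ?thesis unfolding bimono_def ..
  qed
qed

section \<open>Growth along laps, and lap partitions\<close>

text \<open>Stated for a family L n because it serves twice: with the variations \<open>fvar\<close>
  and with the functions \<tau>^n L for a limit L. Inside a lap, the estimates on thirds add up
  without loss.\<close>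

lemma lap_expansion_bound:
  fixes L :: "nat \<Rightarrow> real \<Rightarrow> real"
  assumes w: "w \<in> Tbar"
    and step: "\<And>n x y. third x y \<Longrightarrow>
      L (Suc n) y - L (Suc n) x \<le> \<bar>L n (stunted_sawtooth w y) - L n (stunted_sawtooth w x)\<bar>"
    and mono: "\<And>n. mono_on {0..1} (L n)"
    and "0 \<le> x" "x \<le> y" "y \<le> 1" and "bimono (stunted_sawtooth w ^^ n) x y"
  shows "L n y - L n x \<le> \<bar>L 0 ((stunted_sawtooth w ^^ n) y) - L 0 ((stunted_sawtooth w ^^ n) x)\<bar>"
  using assms(4-7)
proof (induction n arbitrary: x y)
  case 0
  then show ?case by simp
next
  case (Suc n)
  let ?f = "stunted_sawtooth w"
  let ?g = "?f ^^ Suc n"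
  have range: "?g u \<in> {0..1}" if "u \<in> {x..y}" for u
    using funpow_stunted_sawtooth_range[OF w, of u "Suc n"] that Suc.prems by auto
  have L0: "bimono (\<lambda>u. L 0 (?g u)) x y"
    using Suc.prems(4) mono[of 0] range unfolding bimono_def monotone_on_def by blast
  show ?case
  proof (rule third_induct[of x y "\<lambda>x y. L (Suc n) y - L (Suc n) x \<le> \<bar>L 0 (?g y) - L 0 (?g x)\<bar>"])
    fix u v assume uv: "third u v" "x \<le> u" "v \<le> y"
    let ?a = "min (?f u) (?f v)" and ?b = "max (?f u) (?f v)"
    have g: "?g = (?f ^^ n) \<circ> ?f" by (rule funpow_Suc_right)
    have "bimono (?f ^^ n) ?a ?b"
    proof (rule bimono_image[of u v ?f "?f ^^ n"])
      show "continuous_on {u..v} ?f" by (rule continuous_on_stunted_sawtooth[OF w])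
      show "bimono ?f u v" by (rule bimono_third[OF w uv(1)])
      show "u \<le> v" using third_01 uv(1) by blast
      show "bimono ((?f ^^ n) \<circ> ?f) u v"
        using bimono_subset[OF Suc.prems(4) uv(2,3)] unfolding g .
    qed
    moreover have "0 \<le> ?a" "?b \<le> 1"
      using stunted_sawtooth_range[OF w] third_01[OF uv(1)] by auto
    ultimately have "L n ?b - L n ?a \<le> \<bar>L 0 ((?f ^^ n) ?b) - L 0 ((?f ^^ n) ?a)\<bar>"
      by (intro Suc.IH) auto
    then have *: "L n ?b - L n ?a \<le> \<bar>L 0 (?g v) - L 0 (?g u)\<bar>"
      unfolding g by (auto simp: min_def max_def abs_minus_commute split: if_splits)
    have "L n ?a \<le> L n ?b"
      using mono[of n] \<open>0 \<le> ?a\<close> \<open>?b \<le> 1\<close> unfolding monotone_on_def by auto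
    then have "\<bar>L n (?f v) - L n (?f u)\<bar> = L n ?b - L n ?a"
      by (auto simp: min_def max_def split: if_splits)
    with step[OF uv(1), of n] * show "L (Suc n) v - L (Suc n) u \<le> \<bar>L 0 (?g v) - L 0 (?g u)\<bar>"
      by linarith
  next
    fix u v t assume *: "x \<le> u" "u \<le> v" "v \<le> t" "t \<le> y"
      "L (Suc n) v - L (Suc n) u \<le> \<bar>L 0 (?g v) - L 0 (?g u)\<bar>"
      "L (Suc n) t - L (Suc n) v \<le> \<bar>L 0 (?g t) - L 0 (?g v)\<bar>"
    \<comment> \<open>The composite is monotone on the lap, so the increments of adjacent pieces
      have the same sign and do not cancel.\<close>
    have "L 0 (?g u) \<le> L 0 (?g v) \<and> L 0 (?g v) \<le> L 0 (?g t)
       \<or> L 0 (?g u) \<ge> L 0 (?g v) \<and> L 0 (?g v) \<ge> L 0 (?g t)"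
    proof -
      have "u \<in> {x..y}" "v \<in> {x..y}" "t \<in> {x..y}" using *(1-4) by auto
      with L0 *(2,3) show ?thesis unfolding bimono_def monotone_on_def by blast
    qed
    with *(5,6) show "L (Suc n) t - L (Suc n) u \<le> \<bar>L 0 (?g t) - L 0 (?g u)\<bar>" by linarith
  qed (use Suc.prems in auto)
qed


text \<open>The condition in \<open>laps_def\<close> with a variable right end point, so that
  partitions can be built from left to right.\<close>

definition lap_partition :: "(real \<Rightarrow> real) \<Rightarrow> nat \<Rightarrow> (nat \<Rightarrow> real) \<Rightarrow> real \<Rightarrow> bool" where
  "lap_partition g k a y \<longleftrightarrow> a 0 = 0 \<and> a k = y \<and> (\<forall>i<k. a i < a (Suc i)) \<and>
     (\<forall>i<k. bimono g (a i) (a (Suc i)))"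

lemma laps_altdef: "laps g = (LEAST k. \<exists>a. lap_partition g k a 1)"
  unfolding laps_def lap_partition_def bimono_def ..

lemma lap_partition_growth:
  fixes L :: "real \<Rightarrow> real"
  assumes "lap_partition g k a 1"
    and "\<And>x y. \<lbrakk>0 \<le> x; x \<le> y; y \<le> 1; bimono g x y\<rbrakk> \<Longrightarrow> L y - L x \<le> C"
  shows "L 1 - L 0 \<le> real k * C"
proof -
  have less: "\<And>i. i < k \<Longrightarrow> a i < a (Suc i)" using assms(1) by (auto simp: lap_partition_def)
  have mono: "a i \<le> a j" if "i \<le> j" "j \<le> k" for i j
    using that
  proof (induction j rule: dec_induct)
    case (step m)
    then show ?case using less[of m] by simp
  qed simp
  have "L (a k) - L (a 0) = (\<Sum>i<k. L (a (Suc i)) - L (a i))"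
    by (rule sum_lessThan_telescope[symmetric])
  also have "\<dots> \<le> (\<Sum>i<k. C)"
  proof (rule sum_mono)
    fix i assume "i \<in> {..<k}"
    then show "L (a (Suc i)) - L (a i) \<le> C"
      using mono[of 0 i] mono[of "Suc i" k] less[of i] assms(1)
      by (intro assms(2)) (auto simp: lap_partition_def)
  qed
  finally show ?thesis using assms(1) by (simp add: lap_partition_def)
qed

text \<open>Pieces of length zero are allowed and counted, so that a new cut may coincide with an
  old one; \<open>pieces_imp_lap_partition\<close> drops them afterwards.\<close>

inductive pieces :: "(real \<Rightarrow> real) \<Rightarrow> real \<Rightarrow> nat \<Rightarrow> bool" for g where
  pieces_0: "pieces g 0 0"
| pieces_Suc: "\<lbrakk>pieces g x k; x \<le> y; bimono g x y\<rbrakk> \<Longrightarrow> pieces g y (Suc k)"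

lemma pieces_imp_lap_partition:
  "pieces g y k \<Longrightarrow> 0 \<le> y \<and> (\<exists>k'\<le>k. \<exists>a. lap_partition g k' a y)"
proof (induction rule: pieces.induct)
  case pieces_0
  then show ?case by (auto simp: lap_partition_def intro!: exI[of _ "\<lambda>_. 0"])
next
  case (pieces_Suc x k y)
  then obtain k' a where a: "k' \<le> k" "lap_partition g k' a x" by blast
  show ?case
  proof (cases "x = y")
    case True
    with a pieces_Suc show ?thesis by (auto intro!: exI[of _ k'])
  next
    case False
    with pieces_Suc a have "lap_partition g (Suc k') (a(Suc k' := y)) y"
      by (auto simp: lap_partition_def less_Suc_eq)
    with a pieces_Suc show ?thesis by (meson Suc_le_mono order.trans)
  qed
qed

text \<open>The second claim is needed because the \<open>LEAST\<close> in \<open>laps\<close> is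
  informative only if some partition exists.\<close>

lemma pieces_laps:
  assumes "pieces g 1 k"
  shows "laps g \<le> k" "\<exists>a. lap_partition g (laps g) a 1"
proof -
  obtain k' a where a: "k' \<le> k" "lap_partition g k' a 1"
    using pieces_imp_lap_partition[OF assms] by blast
  then have *: "\<exists>a. lap_partition g k' a 1" by blast
  show "\<exists>a. lap_partition g (laps g) a 1" unfolding laps_altdef by (rule LeastI[of "\<lambda>k. \<exists>a. lap_partition g k a 1", OF *])
  have "laps g \<le> k'" unfolding laps_altdef by (rule Least_le[of "\<lambda>k. \<exists>a. lap_partition g k a 1", OF *])
  with a show "laps g \<le> k" by simp
qed

section \<open>Variation of the iterates\<close>

text \<open>\<open>fvar w \<phi> n x\<close> is the total variation on \<open>[0, x]\<close> of \<open>\<phi>\<close> composed with the \<open>n\<close>-th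
  iterate, for increasing \<open>\<phi>\<close> with \<open>\<phi> 0 = 0\<close>. The three summands are the contributions of the
  three branches; writing them without case distinction makes the continuity in \<open>w\<close> and \<open>x\<close>
  visible.\<close>

primrec fvar :: "real \<times> real \<Rightarrow> (real \<Rightarrow> real) \<Rightarrow> nat \<Rightarrow> real \<Rightarrow> real" where
  "fvar w \<phi> 0 x = \<phi> x"
| "fvar w \<phi> (Suc n) x =
     fvar w \<phi> n (stunted_sawtooth w (min x (1/3)))
     + (fvar w \<phi> n (fst w) - fvar w \<phi> n (stunted_sawtooth w (max (1/3) (min x (2/3)))))
     + (fvar w \<phi> n (stunted_sawtooth w (max x (2/3))) - fvar w \<phi> n (snd w))"

declare fvar.simps(2) [simp del]

text \<open>On one third the clamps make two of the three summands in \<open>fvar.simps(2)\<close>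
  vanish or stay constant. Monotonicity at level n is a hypothesis because \<open>fvar_mono\<close>
  obtains level n + 1 from this lemma; \<open>fvar_third\<close> then discharges it.\<close>

lemma fvar_third':
  assumes w: "w \<in> Tbar" and xy: "third x y" and mono: "mono_on {0..1} (fvar w \<phi> n)"
  shows "fvar w \<phi> (Suc n) y - fvar w \<phi> (Suc n) x =
    \<bar>fvar w \<phi> n (stunted_sawtooth w y) - fvar w \<phi> n (stunted_sawtooth w x)\<bar>"
proof -
  let ?f = "stunted_sawtooth w"
  have range: "0 \<le> ?f x" "?f x \<le> 1" "0 \<le> ?f y" "?f y \<le> 1"
    using stunted_sawtooth_range[OF w] third_01[OF xy] by auto
  have M: "fvar w \<phi> n u \<le> fvar w \<phi> n v" if "0 \<le> u" "u \<le> v" "v \<le> 1" for u v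
    using mono that unfolding monotone_on_def by auto
  consider "0 \<le> x" "x \<le> y" "y \<le> 1/3" | "1/3 \<le> x" "x \<le> y" "y \<le> 2/3" | "2/3 \<le> x" "x \<le> y" "y \<le> 1"
    using xy unfolding third_def by blast
  then show ?thesis
  proof cases
    case 1
    then have "?f x \<le> ?f y" using w by (auto simp: stunted_sawtooth_def)
    then have "fvar w \<phi> n (?f x) \<le> fvar w \<phi> n (?f y)" using M range by blast
    moreover have "min x (1/3) = x" "min y (1/3) = y" "min x (2/3) = x" "min y (2/3) = y"
      "max (1/3) x = 1/3" "max (1/3) y = 1/3" "max x (2/3) = 2/3" "max y (2/3) = 2/3"
      using 1 by auto
    ultimately show ?thesis by (simp add: fvar.simps(2))
  next
    case 2
    then have "?f y \<le> ?f x" using Tbar_bounds[OF w]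
      by (auto simp: stunted_sawtooth_altdef[OF w] min_def max_def)
    then have "fvar w \<phi> n (?f y) \<le> fvar w \<phi> n (?f x)" using M range by blast
    moreover have "min x (1/3) = 1/3" "min y (1/3) = 1/3" "min x (2/3) = x" "min y (2/3) = y"
      "max (1/3) x = x" "max (1/3) y = y" "max x (2/3) = 2/3" "max y (2/3) = 2/3"
      using 2 by auto
    ultimately show ?thesis by (simp add: fvar.simps(2))
  next
    case 3
    then have "?f x \<le> ?f y" using Tbar_bounds[OF w]
      by (auto simp: stunted_sawtooth_altdef[OF w] min_def max_def)
    then have "fvar w \<phi> n (?f x) \<le> fvar w \<phi> n (?f y)" using M range by blast
    moreover have "min x (1/3) = 1/3" "min y (1/3) = 1/3" "min x (2/3) = 2/3" "min y (2/3) = 2/3"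
      "max (1/3) (2/3) = (2/3::real)" "max x (2/3) = x" "max y (2/3) = y"
      using 3 by auto
    ultimately show ?thesis by (simp add: fvar.simps(2))
  qed
qed

lemma fvar_mono:
  assumes w: "w \<in> Tbar" and \<phi>: "mono_on {0..1} \<phi>"
  shows "mono_on {0..1} (fvar w \<phi> n)"
proof (induction n)
  case 0
  have "fvar w \<phi> 0 = \<phi>" by auto
  with \<phi> show ?case by simp
next
  case (Suc n)
  have *: "fvar w \<phi> (Suc n) x \<le> fvar w \<phi> (Suc n) y" if xy: "0 \<le> x" "x \<le> y" "y \<le> 1" for x y
  proof (rule third_induct[of x y "\<lambda>x y. fvar w \<phi> (Suc n) x \<le> fvar w \<phi> (Suc n) y"])
    fix u v assume "third u v"
    from fvar_third'[OF w this Suc.IH] show "fvar w \<phi> (Suc n) u \<le> fvar w \<phi> (Suc n) v" by linarith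
  qed (use xy in auto)
  show ?case by (rule monotone_onI) (rule *; simp)
qed

lemmas fvar_third = fvar_third'[OF _ _ fvar_mono]

lemma fvar_le:
  assumes "w \<in> Tbar" "mono_on {0..1} \<phi>" "0 \<le> x" "x \<le> y" "y \<le> 1"
  shows "fvar w \<phi> n x \<le> fvar w \<phi> n y"
  using fvar_mono[OF assms(1,2), of n] assms(3-) unfolding monotone_on_def by auto

lemma fvar_0 [simp]:
  assumes "w \<in> Tbar"
  shows "fvar w \<phi> n 0 = \<phi> 0"
proof (induction n)
  case (Suc n)
  have "max (1/3) (0::real) = 1/3" "max 0 (2/3::real) = 2/3" by auto
  then show ?case using assms Suc by (simp add: fvar.simps(2))
qed simp

text \<open>Induction along the orbit on a third, and the triangle inequality across thirds. It
  bounds the crossings of one monotone piece by a quantity that is additive over pieces.\<close>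

lemma fvar_ge:
  assumes w: "w \<in> Tbar" and \<phi>: "mono_on {0..1} \<phi>" and xy: "0 \<le> x" "x \<le> y" "y \<le> 1"
  shows "\<bar>\<phi> ((stunted_sawtooth w ^^ n) y) - \<phi> ((stunted_sawtooth w ^^ n) x)\<bar>
    \<le> fvar w \<phi> n y - fvar w \<phi> n x"
  using xy
proof (induction n arbitrary: x y)
  case 0
  then have "\<phi> x \<le> \<phi> y" using \<phi> unfolding monotone_on_def by auto
  then show ?case by simp
next
  case (Suc n)
  let ?f = "stunted_sawtooth w"
  let ?g = "?f ^^ Suc n"
  show ?case
  proof (rule third_induct[of x y "\<lambda>x y. \<bar>\<phi> (?g y) - \<phi> (?g x)\<bar> \<le> fvar w \<phi> (Suc n) y - fvar w \<phi> (Suc n) x"])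
    fix u v assume uv: "third u v"
    have r: "0 \<le> ?f u" "?f u \<le> 1" "0 \<le> ?f v" "?f v \<le> 1"
      using stunted_sawtooth_range[OF w] third_01[OF uv] by auto
    have "\<bar>\<phi> ((?f ^^ n) (?f v)) - \<phi> ((?f ^^ n) (?f u))\<bar> \<le> \<bar>fvar w \<phi> n (?f v) - fvar w \<phi> n (?f u)\<bar>"
    proof (cases "?f u \<le> ?f v")
      case True
      from Suc.IH[OF _ this] r show ?thesis by simp
    next
      case False
      then have "?f v \<le> ?f u" by simp
      from Suc.IH[OF _ this] r show ?thesis by simp
    qed
    then show "\<bar>\<phi> (?g v) - \<phi> (?g u)\<bar> \<le> fvar w \<phi> (Suc n) v - fvar w \<phi> (Suc n) u"
      unfolding fvar_third[OF w uv w \<phi>] by (simp only: funpow_Suc_right o_apply)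
  qed (use Suc.prems in auto)
qed

section \<open>Crossings and lap numbers bound each other\<close>

text \<open>Crossings are counted at the turning points of the full sawtooth map rather than at the plateaus,
  so that the degenerate plateaus at \<open>fst w = 1\<close> and \<open>snd w = 0\<close> need no separate treatment.\<close>

definition crossing :: "real \<Rightarrow> real" where
  "crossing x = (if x > 1/3 then 1 else 0) + (if x > 2/3 then 1 else 0)"

lemma mono_crossing: "mono_on A crossing"
  by (intro monotone_onI) (auto simp: crossing_def)

lemma crossing_0 [simp]: "crossing 0 = 0"
  by (simp add: crossing_def)

lemma crossing_bounds: "0 \<le> crossing x" "crossing x \<le> 2"
  by (auto simp: crossing_def)

text \<open>A monotone piece of the \<open>n\<close>-th iterate only has to be cut where it crosses one of the
  turning points \<open>1/3\<close>, \<open>2/3\<close>.\<close>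

lemma pieces_comp_third:
  assumes "w \<in> Tbar" "pieces (stunted_sawtooth w \<circ> g) x k" "x \<le> y" "bimono g x y"
    "third (min (g x) (g y)) (max (g x) (g y))"
  shows "pieces (stunted_sawtooth w \<circ> g) y (Suc k)"
  using pieces_Suc[OF assms(2,3)] bimono_comp[OF assms(4) bimono_third[OF assms(1,5)]] by simp

lemma pieces_comp:
  assumes w: "w \<in> Tbar" and g: "continuous_on {0..1} g"
    and range: "\<And>x. x \<in> {0..1} \<Longrightarrow> g x \<in> {0..1}"
    and mono: "bimono g x y" and xy: "0 \<le> x" "x \<le> y" "y \<le> 1"
    and p: "pieces (stunted_sawtooth w \<circ> g) x k"
  shows "\<exists>k'. pieces (stunted_sawtooth w \<circ> g) y k' \<and>
    real k' \<le> real k + 1 + \<bar>crossing (g y) - crossing (g x)\<bar>"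
proof -
  have r: "0 \<le> g x" "g x \<le> 1" "0 \<le> g y" "g y \<le> 1" using range[of x] range[of y] xy by auto
  have ivt: "\<exists>z. u \<le> z \<and> z \<le> v \<and> g z = c"
    if "min (g u) (g v) \<le> c" "c \<le> max (g u) (g v)" "x \<le> u" "u \<le> v" "v \<le> y" for u v c
    using that IVT'[of g u c v] IVT2'[of g v c u] continuous_on_subset[OF g, of "{u..v}"] xy
    by (auto simp: min_def max_def split: if_splits)
  consider (zero) "crossing (g y) = crossing (g x)"
    | (one) "\<bar>crossing (g y) - crossing (g x)\<bar> = 1"
    | (two) "\<bar>crossing (g y) - crossing (g x)\<bar> = 2"
  proof -
    have "crossing u \<in> {0, 1, 2}" for u by (auto simp: crossing_def)
    from this[of "g x"] this[of "g y"] that show thesis by auto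
  qed
  then show ?thesis
  proof cases
    case zero
    then have "third (min (g x) (g y)) (max (g x) (g y))"
      using r by (auto simp: third_def crossing_def min_def max_def split: if_splits)
    from pieces_comp_third[OF w p xy(2) mono this] show ?thesis by (intro exI[of _ "Suc k"]) auto
  next
    case one
    \<comment> \<open>The only turning point between the two end values.\<close>
    define c where "c = (if min (g x) (g y) \<le> 1/3 then 1/3 else 2/3 :: real)"
    have c: "min (g x) (g y) \<le> c" "c \<le> max (g x) (g y)"
      "third (min (g x) c) (max (g x) c)" "third (min c (g y)) (max c (g y))"
      using one r by (auto simp: c_def crossing_def third_def min_def max_def split: if_splits)
    obtain z where z: "x \<le> z" "z \<le> y" "g z = c" using ivt[OF c(1,2)] xy by blast
    have "pieces (stunted_sawtooth w \<circ> g) z (Suc k)"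
      by (rule pieces_comp_third[OF w p z(1)]) (use bimono_subset[OF mono] z c in auto)
    then have "pieces (stunted_sawtooth w \<circ> g) y (Suc (Suc k))"
      by (rule pieces_comp_third[OF w _ z(2)]) (use bimono_subset[OF mono] z c in auto)
    then show ?thesis using one by (intro exI[of _ "Suc (Suc k)"]) auto
  next
    case two
    \<comment> \<open>Both turning points are crossed: c is the one met first, and d is the other,
      as 1/3 + 2/3 = 1.\<close>
    define c where "c = (if g x \<le> 1/3 then 1/3 else 2/3 :: real)"
    define d where "d = 1 - c"
    have c: "min (g x) (g y) \<le> c" "c \<le> max (g x) (g y)" "min c (g y) \<le> d" "d \<le> max c (g y)"
      "third (min (g x) c) (max (g x) c)" "third (min c d) (max c d)" "third (min d (g y)) (max d (g y))"
      using two r by (auto simp: c_def d_def crossing_def third_def min_def max_def split: if_splits)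
    obtain z where z: "x \<le> z" "z \<le> y" "g z = c" using ivt[OF c(1,2)] xy by blast
    obtain z' where z': "z \<le> z'" "z' \<le> y" "g z' = d" using ivt[of z y d] z c by auto
    have "pieces (stunted_sawtooth w \<circ> g) z (Suc k)"
      by (rule pieces_comp_third[OF w p z(1)]) (use bimono_subset[OF mono] z c in auto)
    then have "pieces (stunted_sawtooth w \<circ> g) z' (Suc (Suc k))"
      by (rule pieces_comp_third[OF w _ z'(1)]) (use bimono_subset[OF mono] z z' c in auto)
    then have "pieces (stunted_sawtooth w \<circ> g) y (Suc (Suc (Suc k)))"
      by (rule pieces_comp_third[OF w _ z'(2)]) (use bimono_subset[OF mono] z z' c in auto)
    then show ?thesis using two by (intro exI[of _ "Suc (Suc (Suc k))"]) auto
  qed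
qed

text \<open>A piece with j crossings yields at most 1 + j pieces of the next iterate, and by
  \<open>fvar_ge\<close> the crossings of all pieces in [0, y] add up to at most the variation
  there.\<close>

lemma pieces_iterate_Suc:
  assumes w: "w \<in> Tbar"
  shows "pieces (stunted_sawtooth w ^^ n) y k \<Longrightarrow> y \<le> 1 \<Longrightarrow>
    \<exists>k'. pieces (stunted_sawtooth w ^^ Suc n) y k' \<and> real k' \<le> real k + fvar w crossing n y"
proof (induction rule: pieces.induct)
  case pieces_0
  show ?case using w pieces.pieces_0 by (intro exI[of _ 0]) auto
next
  case (pieces_Suc x k y)
  let ?g = "stunted_sawtooth w ^^ n"
  have x: "0 \<le> x" using pieces_imp_lap_partition[OF pieces_Suc.hyps(1)] by blast
  obtain k' where k': "pieces (stunted_sawtooth w \<circ> ?g) x k'" "real k' \<le> real k + fvar w crossing n x"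
  proof -
    have "x \<le> 1" using pieces_Suc.hyps(2) pieces_Suc.prems by simp
    from pieces_Suc.IH[OF this] that show thesis unfolding funpow.simps(2) by blast
  qed
  have "\<exists>k''. pieces (stunted_sawtooth w \<circ> ?g) y k'' \<and> real k'' \<le> real k' + 1 + \<bar>crossing (?g y) - crossing (?g x)\<bar>"
    by (rule pieces_comp[OF w continuous_on_funpow_stunted_sawtooth[OF w] _ pieces_Suc.hyps(3) x _ _ k'(1)])
      (use pieces_Suc funpow_stunted_sawtooth_range[OF w] in auto)
  then obtain k'' where k'': "pieces (stunted_sawtooth w \<circ> ?g) y k''"
    "real k'' \<le> real k' + 1 + \<bar>crossing (?g y) - crossing (?g x)\<bar>" by blast
  have "\<bar>crossing (?g y) - crossing (?g x)\<bar> \<le> fvar w crossing n y - fvar w crossing n x"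
    by (rule fvar_ge[OF w mono_crossing]) (use x pieces_Suc in auto)
  with k' k'' show ?case unfolding funpow.simps(2) by (intro exI[of _ k''] conjI) (assumption, linarith)
qed

lemma pieces_iterate:
  assumes w: "w \<in> Tbar"
  shows "\<exists>k. pieces (stunted_sawtooth w ^^ n) 1 k \<and> real k \<le> 1 + (\<Sum>i<n. fvar w crossing i 1)"
proof (induction n)
  case 0
  have "pieces (stunted_sawtooth w ^^ 0) 1 (Suc 0)"
    by (rule pieces_Suc[OF pieces_0]) (auto simp: bimono_def monotone_on_def)
  then show ?case by (intro exI[of _ "Suc 0"] conjI) (assumption, simp)
next
  case (Suc n)
  then obtain k where "pieces (stunted_sawtooth w ^^ n) 1 k" "real k \<le> 1 + (\<Sum>i<n. fvar w crossing i 1)"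
    by blast
  with pieces_iterate_Suc[OF w this(1)] show ?case by (force simp del: funpow.simps)
qed

lemma laps_le_sum_fvar:
  assumes "w \<in> Tbar"
  shows "real (laps (stunted_sawtooth w ^^ n)) \<le> 1 + (\<Sum>i<n. fvar w crossing i 1)"
  using pieces_iterate[OF assms, of n] pieces_laps(1) by fastforce

lemma ex_lap_partition:
  assumes "w \<in> Tbar"
  shows "\<exists>a. lap_partition (stunted_sawtooth w ^^ n) (laps (stunted_sawtooth w ^^ n)) a 1"
  using pieces_iterate[OF assms, of n] pieces_laps(2) by blast

lemma laps_ge_1:
  assumes "w \<in> Tbar"
  shows "1 \<le> laps (stunted_sawtooth w ^^ n)"
  using ex_lap_partition[OF assms, of n] by (auto simp: lap_partition_def Suc_le_eq intro!: gr0I)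

text \<open>Each lap contributes at most the full range of L 0. With \<open>fvar\<close> this bounds
  v(n) by lap numbers; with \<tau>^n L it bounds lap numbers below by \<tau>^n.\<close>

lemma lap_growth:
  fixes L :: "nat \<Rightarrow> real \<Rightarrow> real"
  assumes w: "w \<in> Tbar"
    and step: "\<And>n x y. third x y \<Longrightarrow>
      L (Suc n) y - L (Suc n) x \<le> \<bar>L n (stunted_sawtooth w y) - L n (stunted_sawtooth w x)\<bar>"
    and mono: "\<And>n. mono_on {0..1} (L n)"
  shows "L n 1 - L n 0 \<le> real (laps (stunted_sawtooth w ^^ n)) * (L 0 1 - L 0 0)"
proof -
  obtain a where a: "lap_partition (stunted_sawtooth w ^^ n) (laps (stunted_sawtooth w ^^ n)) a 1"
    using ex_lap_partition[OF w] by blast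
  show ?thesis
  proof (rule lap_partition_growth[OF a])
    fix x y assume xy: "0 \<le> x" "x \<le> y" "y \<le> (1::real)" "bimono (stunted_sawtooth w ^^ n) x y"
    let ?u = "(stunted_sawtooth w ^^ n) x" and ?v = "(stunted_sawtooth w ^^ n) y"
    have "?u \<in> {0..1}" "?v \<in> {0..1}" using funpow_stunted_sawtooth_range[OF w] xy by auto
    then have "L 0 0 \<le> L 0 ?u" "L 0 ?u \<le> L 0 1" "L 0 0 \<le> L 0 ?v" "L 0 ?v \<le> L 0 1"
      using mono[of 0] unfolding monotone_on_def by auto
    with lap_expansion_bound[of w L x y n, OF w step mono xy] show "L n y - L n x \<le> L 0 1 - L 0 0" by linarith
  qed
qed

lemma fvar_le_laps:
  assumes "w \<in> Tbar" "mono_on {0..1} \<phi>"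
  shows "fvar w \<phi> n 1 - \<phi> 0 \<le> real (laps (stunted_sawtooth w ^^ n)) * (\<phi> 1 - \<phi> 0)"
  using lap_growth[of w "fvar w \<phi>" n] fvar_third fvar_mono assms by auto

section \<open>Monotonicity in the parameters\<close>

lemma stunted_sawtooth_branches:
  assumes "w \<in> Tbar"
  shows "0 \<le> x \<Longrightarrow> x \<le> 1/3 \<Longrightarrow> stunted_sawtooth w x = min (3 * x) (fst w)"
    and "1/3 \<le> x \<Longrightarrow> x \<le> 2/3 \<Longrightarrow> stunted_sawtooth w x = max (snd w) (min (fst w) (2 - 3 * x))"
    and "2/3 \<le> x \<Longrightarrow> x \<le> 1 \<Longrightarrow> stunted_sawtooth w x = max (3 * x - 2) (snd w)"
  using Tbar_bounds[OF assms] by (auto simp: stunted_sawtooth_altdef[OF assms] min_def max_def)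

text \<open>Raising the top and lowering the bottom only unclips the map: between two points of a
  third, S_w either has equal values or its image interval lies inside that of S_w'.\<close>

lemma fvar_mono_param:
  assumes w: "w \<in> Tbar" and w': "w' \<in> Tbar" and le: "fst w \<le> fst w'" "snd w' \<le> snd w"
    and \<phi>: "mono_on {0..1} \<phi>" and xy: "0 \<le> x" "x \<le> y" "y \<le> 1"
  shows "fvar w \<phi> n y - fvar w \<phi> n x \<le> fvar w' \<phi> n y - fvar w' \<phi> n x"
  using xy
proof (induction n arbitrary: x y)
  case (Suc n)
  let ?f = "stunted_sawtooth w" and ?f' = "stunted_sawtooth w'"
  show ?case
  proof (rule third_induct[of x y "\<lambda>x y. fvar w \<phi> (Suc n) y - fvar w \<phi> (Suc n) x
      \<le> fvar w' \<phi> (Suc n) y - fvar w' \<phi> (Suc n) x"])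
    fix u v assume uv: "third u v"
    then have uv01: "0 \<le> u" "u \<le> v" "v \<le> 1" using third_01 by auto
    have r: "0 \<le> ?f u" "?f u \<le> 1" "0 \<le> ?f v" "?f v \<le> 1" "0 \<le> ?f' u" "?f' u \<le> 1" "0 \<le> ?f' v" "?f' v \<le> 1"
      using stunted_sawtooth_range[OF w] stunted_sawtooth_range[OF w'] uv01 by auto
    have mono': "fvar w' \<phi> n p \<le> fvar w' \<phi> n q" if "0 \<le> p" "p \<le> q" "q \<le> 1" for p q
      using fvar_le[OF w' \<phi> that] .
    have "?f u = ?f v \<or> (?f' u \<le> ?f u \<and> ?f u \<le> ?f v \<and> ?f v \<le> ?f' v)
      \<or> (?f' v \<le> ?f v \<and> ?f v \<le> ?f u \<and> ?f u \<le> ?f' u)"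
    proof -
      consider "0 \<le> u" "u \<le> v" "v \<le> 1/3" | "1/3 \<le> u" "u \<le> v" "v \<le> 2/3" | "2/3 \<le> u" "u \<le> v" "v \<le> 1"
        using uv unfolding third_def by blast
      then show ?thesis
      proof cases
        case 1
        then show ?thesis
          using le by (simp add: stunted_sawtooth_branches(1)[OF w] stunted_sawtooth_branches(1)[OF w']) linarith
      next
        case 2
        then show ?thesis
          using le Tbar_bounds[OF w] Tbar_bounds[OF w']
          by (simp add: stunted_sawtooth_branches(2)[OF w] stunted_sawtooth_branches(2)[OF w'] min_def max_def)
      next
        case 3
        then show ?thesis
          using le by (simp add: stunted_sawtooth_branches(3)[OF w] stunted_sawtooth_branches(3)[OF w']) linarith
      qed
    qed
    then have "\<bar>fvar w \<phi> n (?f v) - fvar w \<phi> n (?f u)\<bar> \<le> \<bar>fvar w' \<phi> n (?f' v) - fvar w' \<phi> n (?f' u)\<bar>"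
    proof (elim disjE conjE)
      assume *: "?f' u \<le> ?f u" "?f u \<le> ?f v" "?f v \<le> ?f' v"
      show ?thesis
        using Suc.IH[OF r(1) *(2) r(4)] fvar_le[OF w \<phi> r(1) *(2) r(4), of n]
          mono'[OF r(5) *(1) r(2)] mono'[OF r(3) *(3) r(8)] by linarith
    next
      assume *: "?f' v \<le> ?f v" "?f v \<le> ?f u" "?f u \<le> ?f' u"
      show ?thesis
        using Suc.IH[OF r(3) *(2) r(2)] fvar_le[OF w \<phi> r(3) *(2) r(2), of n]
          mono'[OF r(7) *(1) r(4)] mono'[OF r(1) *(3) r(6)] by linarith
    qed simp
    then show "fvar w \<phi> (Suc n) v - fvar w \<phi> (Suc n) u \<le> fvar w' \<phi> (Suc n) v - fvar w' \<phi> (Suc n) u"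
      by (simp add: fvar_third w w' uv \<phi>)
  qed (use Suc.prems in auto)
qed simp

section \<open>Limits in the parameters\<close>

text \<open>The induction needs x to move together with w, since \<open>fvar.simps(2)\<close>
  evaluates level n at points that depend on w.\<close>

lemma fvar_tendsto:
  assumes w: "w \<in> Tbar" and W: "\<And>k. W k \<in> Tbar" "W \<longlonglongrightarrow> w"
    and \<phi>: "continuous_on UNIV \<phi>" and x: "x \<longlonglongrightarrow> a"
  shows "(\<lambda>k. fvar (W k) \<phi> n (x k)) \<longlonglongrightarrow> fvar w \<phi> n a"
  using x
proof (induction n arbitrary: x a)
  case 0
  then show ?case using \<phi> by (auto intro: isCont_tendsto_compose simp: continuous_on_eq_continuous_within)
next
  case (Suc n)
  have f: "(\<lambda>k. stunted_sawtooth (W k) (y k)) \<longlonglongrightarrow> stunted_sawtooth w b" if "y \<longlonglongrightarrow> b" for y b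
    by (rule stunted_sawtooth_tendsto) (use w W that in auto)
  show ?case
    unfolding fvar.simps(2) by (intro tendsto_add tendsto_diff Suc.IH f tendsto_intros W(2) Suc.prems)
qed

text \<open>Continuous increasing approximations of \<open>crossing\<close> from below, since
  \<open>fvar_tendsto\<close> does not apply to a function with jumps.\<close>

definition ramp :: "nat \<Rightarrow> real \<Rightarrow> real" where
  "ramp j x = max 0 (min 1 (real j * (x - 1/3))) + max 0 (min 1 (real j * (x - 2/3)))"

lemma ramp_tendsto: "(\<lambda>j. ramp j x) \<longlonglongrightarrow> crossing x"
proof -
  have "(\<lambda>j. max 0 (min 1 (real j * (x - c)))) \<longlonglongrightarrow> (if x > c then 1 else 0)" for c
  proof (cases "x > c")
    case True
    then have "filterlim (\<lambda>j. real j * (x - c)) at_top sequentially"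
      by (intro filterlim_at_top_mult_tendsto_pos[OF tendsto_const] filterlim_real_sequentially) auto
    then have "\<forall>\<^sub>F j in sequentially. 1 \<le> real j * (x - c)" by (simp add: filterlim_at_top)
    then have "\<forall>\<^sub>F j in sequentially. 1 = max 0 (min 1 (real j * (x - c)))"
      by eventually_elim auto
    then show ?thesis using True by (auto intro: Lim_transform_eventually[OF tendsto_const])
  next
    case False
    then have "real j * (x - c) \<le> 0" for j by (simp add: mult_nonneg_nonpos)
    then have "max 0 (min 1 (real j * (x - c))) = 0" for j
      by (metis max_absorb1 min.coboundedI2)
    then show ?thesis using False by simp
  qed
  from tendsto_add[OF this[of "1/3"] this[of "2/3"]] show ?thesis by (simp add: ramp_def crossing_def)
qed

lemma ramp_mono: "mono_on A (ramp j)"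
proof (rule monotone_onI)
  fix x y :: real assume "x \<le> y"
  then have "real j * (x - c) \<le> real j * (y - c)" for c by (simp add: mult_left_mono)
  from this[of "1/3"] this[of "2/3"] show "ramp j x \<le> ramp j y"
    unfolding ramp_def by (intro add_mono max.mono min.mono) auto
qed

lemma ramp_bounds: "0 \<le> ramp j x" "ramp j x \<le> 2"
  unfolding ramp_def by linarith+

lemma fvar_tendsto_arg:
  assumes "\<And>x. (\<lambda>j. \<phi> j x) \<longlonglongrightarrow> \<psi> x"
  shows "(\<lambda>j. fvar w (\<phi> j) n x) \<longlonglongrightarrow> fvar w \<psi> n x"
proof (induction n arbitrary: x)
  case (Suc n)
  show ?case unfolding fvar.simps(2) by (intro tendsto_add tendsto_diff Suc.IH)
qed (simp add: assms)

text \<open>The order of limits matters: k tends to infinity for a fixed ramp, then j. The bound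
  survives because it is uniform in j; the 2 is the total rise of a ramp.\<close>

lemma fvar_crossing_le:
  assumes w: "w \<in> Tbar" and W: "\<And>k. W k \<in> Tbar" "W \<longlonglongrightarrow> w"
    and bound: "\<And>k. real (laps (stunted_sawtooth (W k) ^^ n)) \<le> C"
  shows "fvar w crossing n 1 \<le> 2 * C"
proof -
  have "fvar w (ramp j) n 1 \<le> 2 * C" for j
  proof -
    have "continuous_on UNIV (ramp j)" unfolding ramp_def by (intro continuous_intros)
    then have "(\<lambda>k. fvar (W k) (ramp j) n 1) \<longlonglongrightarrow> fvar w (ramp j) n 1"
      by (rule fvar_tendsto[OF w W _ tendsto_const])
    moreover have "fvar (W k) (ramp j) n 1 \<le> 2 * C" for k
    proof -
      have "ramp j 0 = 0" by (simp add: ramp_def)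
      then have "fvar (W k) (ramp j) n 1 \<le> real (laps (stunted_sawtooth (W k) ^^ n)) * ramp j 1"
        using fvar_le_laps[OF W(1) ramp_mono, of k j n] by simp
      also have "\<dots> \<le> real (laps (stunted_sawtooth (W k) ^^ n)) * 2"
        using ramp_bounds[of j 1] by (intro mult_left_mono) auto
      also have "\<dots> \<le> 2 * C" using bound[of k] by simp
      finally show ?thesis .
    qed
    ultimately show ?thesis by (intro LIMSEQ_le_const2) auto
  qed
  moreover have "(\<lambda>j. fvar w (ramp j) n 1) \<longlonglongrightarrow> fvar w crossing n 1"
    by (rule fvar_tendsto_arg[OF ramp_tendsto])
  ultimately show ?thesis by (intro LIMSEQ_le_const2) auto
qed

section \<open>Asymptotic equicontinuity\<close>

lemma stunted_sawtooth_lipschitz: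
  assumes "w \<in> Tbar" "w' \<in> Tbar"
  shows "\<bar>stunted_sawtooth w' y - stunted_sawtooth w x\<bar>
    \<le> 3 * \<bar>y - x\<bar> + \<bar>fst w' - fst w\<bar> + \<bar>snd w' - snd w\<bar>"
proof -
  have min: "\<bar>min a b - min a' b'\<bar> \<le> d" if "\<bar>a - a'\<bar> \<le> d" "\<bar>b - b'\<bar> \<le> d" for a b a' b' d :: real
    using that by linarith
  have max: "\<bar>max a b - max a' b'\<bar> \<le> d" if "\<bar>a - a'\<bar> \<le> d" "\<bar>b - b'\<bar> \<le> d" for a b a' b' d :: real
    using that by linarith
  define A where "A = \<bar>fst w' - fst w\<bar>"
  define B where "B = \<bar>snd w' - snd w\<bar>"
  have "\<bar>fst w' - fst w\<bar> \<le> 3 * \<bar>y - x\<bar> + A + B" "\<bar>snd w' - snd w\<bar> \<le> 3 * \<bar>y - x\<bar> + A + B"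
    by (auto simp: A_def B_def)
  moreover have "0 \<le> A" "0 \<le> B" by (auto simp: A_def B_def)
  then have "\<bar>3 * y - 3 * x\<bar> \<le> 3 * \<bar>y - x\<bar> + A + B"
    "\<bar>2 - 3 * y - (2 - 3 * x)\<bar> \<le> 3 * \<bar>y - x\<bar> + A + B"
    "\<bar>3 * y - 2 - (3 * x - 2)\<bar> \<le> 3 * \<bar>y - x\<bar> + A + B" by (auto simp: abs_if)
  ultimately show ?thesis
    unfolding stunted_sawtooth_altdef[OF assms(1)] stunted_sawtooth_altdef[OF assms(2)]
    unfolding A_def B_def by (intro min max)
qed

text \<open>The l k stand for normalised partial sums. The error c k leaves room for the normalised
  crossing jumps, which vanish only in the limit.\<close>

locale expanding_limit =
  fixes W :: "nat \<Rightarrow> real \<times> real" and w :: "real \<times> real" and c :: "nat \<Rightarrow> real" and t :: real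
    and l :: "nat \<Rightarrow> real \<Rightarrow> real"
  assumes w: "w \<in> Tbar" and W: "\<And>k. W k \<in> Tbar" and lim: "W \<longlonglongrightarrow> w"
    and t: "0 < t" "t < 1" and c: "c \<longlonglongrightarrow> 0"
    and mono: "\<And>k. mono_on {0..1} (l k)"
    and range: "\<And>k x. x \<in> {0..1} \<Longrightarrow> l k x \<in> {0..1}"
    and expand: "\<And>k x y. third x y \<Longrightarrow>
      l k y - l k x \<le> c k + t * \<bar>l k (stunted_sawtooth (W k) y) - l k (stunted_sawtooth (W k) x)\<bar>"
begin

text \<open>One neighbourhood of x has to serve all large k; this is what makes the bound usable at
  points that move with k.\<close>

definition osc :: "real \<Rightarrow> real \<Rightarrow> bool" where
  "osc \<eta> x \<longleftrightarrow> (\<exists>\<epsilon>>0. \<forall>\<^sub>F k in sequentially. \<forall>y z. 0 \<le> y \<longrightarrow> y \<le> z \<longrightarrow> z \<le> 1 \<longrightarrow>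
     \<bar>y - x\<bar> \<le> \<epsilon> \<longrightarrow> \<bar>z - x\<bar> \<le> \<epsilon> \<longrightarrow> l k z - l k y \<le> \<eta>)"

text \<open>Restricted to pairs within one third, where \<open>expand\<close> applies.\<close>

definition osc3 :: "real \<Rightarrow> real \<Rightarrow> bool" where
  "osc3 \<eta> x \<longleftrightarrow> (\<exists>\<epsilon>>0. \<forall>\<^sub>F k in sequentially. \<forall>y z. third y z \<longrightarrow>
     \<bar>y - x\<bar> \<le> \<epsilon> \<longrightarrow> \<bar>z - x\<bar> \<le> \<epsilon> \<longrightarrow> l k z - l k y \<le> \<eta>)"

lemma osc_mono: "osc \<eta> x \<Longrightarrow> \<eta> \<le> \<eta>' \<Longrightarrow> osc \<eta>' x"
proof -
  assume "osc \<eta> x" "\<eta> \<le> \<eta>'"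
  then obtain \<epsilon> where \<epsilon>: "\<epsilon> > 0" "\<forall>\<^sub>F k in sequentially. \<forall>y z. 0 \<le> y \<longrightarrow> y \<le> z \<longrightarrow> z \<le> 1 \<longrightarrow>
     \<bar>y - x\<bar> \<le> \<epsilon> \<longrightarrow> \<bar>z - x\<bar> \<le> \<epsilon> \<longrightarrow> l k z - l k y \<le> \<eta>" unfolding osc_def by blast
  have "\<forall>\<^sub>F k in sequentially. \<forall>y z. 0 \<le> y \<longrightarrow> y \<le> z \<longrightarrow> z \<le> 1 \<longrightarrow>
     \<bar>y - x\<bar> \<le> \<epsilon> \<longrightarrow> \<bar>z - x\<bar> \<le> \<epsilon> \<longrightarrow> l k z - l k y \<le> \<eta>'"
    using \<epsilon>(2) by eventually_elim (meson \<open>\<eta> \<le> \<eta>'\<close> order.trans)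
  with \<epsilon>(1) show ?thesis unfolding osc_def by blast
qed

lemma osc_1: "osc 1 x"
proof -
  have "l k z - l k y \<le> 1" if "0 \<le> y" "y \<le> z" "z \<le> 1" for k y z
    using range[of y k] range[of z k] that by auto
  then show ?thesis unfolding osc_def by (intro exI[of _ 1]) auto
qed

text \<open>The oscillations on the two sides of a turning point add up. As 2 * t may exceed 1, this
  step cannot be iterated; elsewhere \<open>osc3_regular\<close> loses nothing.\<close>

lemma osc3_turning:
  assumes "osc3 \<eta> x" "0 \<le> \<eta>"
  shows "osc (2 * \<eta>) x"
proof -
  obtain \<epsilon> where \<epsilon>: "\<epsilon> > 0" "\<forall>\<^sub>F k in sequentially. \<forall>y z. third y z \<longrightarrow>
     \<bar>y - x\<bar> \<le> \<epsilon> \<longrightarrow> \<bar>z - x\<bar> \<le> \<epsilon> \<longrightarrow> l k z - l k y \<le> \<eta>" using assms(1) unfolding osc3_def by blast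
  \<comment> \<open>Points within 1/7 of x are less than 1/3 apart, so at most one turning point
    separates them.\<close>
  have "\<forall>\<^sub>F k in sequentially. \<forall>y z. 0 \<le> y \<longrightarrow> y \<le> z \<longrightarrow> z \<le> 1 \<longrightarrow>
     \<bar>y - x\<bar> \<le> min \<epsilon> (1/7) \<longrightarrow> \<bar>z - x\<bar> \<le> min \<epsilon> (1/7) \<longrightarrow> l k z - l k y \<le> 2 * \<eta>"
    using \<epsilon>(2)
  proof eventually_elim
    case (elim k)
    show ?case
    proof (intro allI impI)
      fix y z assume yz: "0 \<le> y" "y \<le> z" "z \<le> 1" "\<bar>y - x\<bar> \<le> min \<epsilon> (1/7)" "\<bar>z - x\<bar> \<le> min \<epsilon> (1/7)"
      then consider "third y z" | "y \<le> 1/3" "1/3 \<le> z" "z \<le> 2/3" | "1/3 \<le> y" "y \<le> 2/3" "2/3 \<le> z"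
        unfolding third_def by linarith
      then show "l k z - l k y \<le> 2 * \<eta>"
      proof cases
        case 1
        then show ?thesis using elim[rule_format, of y z] yz assms(2) by auto
      next
        case 2
        then have "third y (1/3)" "third (1/3) z" using yz by (auto simp: third_def)
        moreover have "\<bar>1/3 - x\<bar> \<le> \<epsilon>" using yz 2 by (auto simp: abs_le_iff)
        ultimately have "l k (1/3) - l k y \<le> \<eta>" "l k z - l k (1/3) \<le> \<eta>" using elim yz by auto
        then show ?thesis by linarith
      next
        case 3
        then have "third y (2/3)" "third (2/3) z" using yz by (auto simp: third_def)
        moreover have "\<bar>2/3 - x\<bar> \<le> \<epsilon>" using yz 3 by (auto simp: abs_le_iff)
        ultimately have "l k (2/3) - l k y \<le> \<eta>" "l k z - l k (2/3) \<le> \<eta>" using elim yz by auto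
        then show ?thesis by linarith
      qed
    qed
  qed
  then show ?thesis unfolding osc_def using \<epsilon>(1) by (intro exI[of _ "min \<epsilon> (1/7)"]) auto
qed

lemma osc3_regular:
  assumes "osc3 \<eta> x" "x \<noteq> 1/3" "x \<noteq> 2/3"
  shows "osc \<eta> x"
proof -
  obtain \<epsilon> where \<epsilon>: "\<epsilon> > 0" "\<forall>\<^sub>F k in sequentially. \<forall>y z. third y z \<longrightarrow>
     \<bar>y - x\<bar> \<le> \<epsilon> \<longrightarrow> \<bar>z - x\<bar> \<le> \<epsilon> \<longrightarrow> l k z - l k y \<le> \<eta>" using assms(1) unfolding osc3_def by blast
  define \<delta> where "\<delta> = min \<epsilon> (min (\<bar>x - 1/3\<bar>) (\<bar>x - 2/3\<bar>) / 2)"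
  have \<delta>: "0 < \<delta>" "\<delta> \<le> \<epsilon>" "2 * \<delta> \<le> \<bar>x - 1/3\<bar>" "2 * \<delta> \<le> \<bar>x - 2/3\<bar>"
    using \<epsilon>(1) assms(2,3) unfolding \<delta>_def by (auto simp: min_def)
  have third: "third y z" if "0 \<le> y" "y \<le> z" "z \<le> 1" "\<bar>y - x\<bar> \<le> \<delta>" "\<bar>z - x\<bar> \<le> \<delta>" for y z
    using that \<delta> unfolding third_def by linarith
  have "\<forall>\<^sub>F k in sequentially. \<forall>y z. 0 \<le> y \<longrightarrow> y \<le> z \<longrightarrow> z \<le> 1 \<longrightarrow>
     \<bar>y - x\<bar> \<le> \<delta> \<longrightarrow> \<bar>z - x\<bar> \<le> \<delta> \<longrightarrow> l k z - l k y \<le> \<eta>"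
    using \<epsilon>(2) by eventually_elim (use third \<delta>(2) in \<open>auto 0 4 intro: order.trans\<close>)
  then show ?thesis unfolding osc_def using \<delta>(1) by blast
qed

lemma dist_lim: "0 < e \<Longrightarrow> \<forall>\<^sub>F k in sequentially. \<bar>fst (W k) - fst w\<bar> + \<bar>snd (W k) - snd w\<bar> < e"
proof -
  assume "0 < e"
  have "(\<lambda>k. \<bar>fst (W k) - fst w\<bar> + \<bar>snd (W k) - snd w\<bar>) \<longlonglongrightarrow> \<bar>fst w - fst w\<bar> + \<bar>snd w - snd w\<bar>"
    by (intro tendsto_intros lim)
  with \<open>0 < e\<close> show ?thesis by (auto dest!: order_tendstoD(2))
qed

lemma osc3_image:
  assumes osc: "osc \<eta> (stunted_sawtooth w x)" and "0 \<le> \<eta>" "t * \<eta> < \<eta>'"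
  shows "osc3 \<eta>' x"
proof -
  obtain \<epsilon> where \<epsilon>: "\<epsilon> > 0" "\<forall>\<^sub>F k in sequentially. \<forall>y z. 0 \<le> y \<longrightarrow> y \<le> z \<longrightarrow> z \<le> 1 \<longrightarrow>
     \<bar>y - stunted_sawtooth w x\<bar> \<le> \<epsilon> \<longrightarrow> \<bar>z - stunted_sawtooth w x\<bar> \<le> \<epsilon> \<longrightarrow> l k z - l k y \<le> \<eta>"
    using osc unfolding osc_def by blast
  have c': "\<forall>\<^sub>F k in sequentially. c k < \<eta>' - t * \<eta>"
    using c assms(3) by (intro order_tendstoD(2)) auto
  \<comment> \<open>Slope at most 3 on radius \<epsilon> / 6 uses half of \<epsilon>; the change
    from w to W k uses the other half.\<close>
  have "0 < \<epsilon> / 2" using \<epsilon>(1) by simp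
  have "\<forall>\<^sub>F k in sequentially. \<forall>y z. third y z \<longrightarrow>
     \<bar>y - x\<bar> \<le> \<epsilon> / 6 \<longrightarrow> \<bar>z - x\<bar> \<le> \<epsilon> / 6 \<longrightarrow> l k z - l k y \<le> \<eta>'"
    using \<epsilon>(2) dist_lim[OF \<open>0 < \<epsilon> / 2\<close>] c'
  proof eventually_elim
    case (elim k)
    let ?f = "stunted_sawtooth (W k)"
    show ?case
    proof (intro allI impI)
      fix y z assume yz: "third y z" "\<bar>y - x\<bar> \<le> \<epsilon> / 6" "\<bar>z - x\<bar> \<le> \<epsilon> / 6"
      have r: "0 \<le> ?f y" "?f y \<le> 1" "0 \<le> ?f z" "?f z \<le> 1"
        using stunted_sawtooth_range[OF W] third_01[OF yz(1)] by auto
      have near: "\<bar>?f y - stunted_sawtooth w x\<bar> \<le> \<epsilon>" "\<bar>?f z - stunted_sawtooth w x\<bar> \<le> \<epsilon>"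
        using stunted_sawtooth_lipschitz[OF w W, of k y x] stunted_sawtooth_lipschitz[OF w W, of k z x]
          elim(2) yz by linarith+
      have "\<bar>l k (?f z) - l k (?f y)\<bar> \<le> \<eta>"
      proof (cases "?f y \<le> ?f z")
        case True
        then have "l k (?f z) - l k (?f y) \<le> \<eta>" "l k (?f y) \<le> l k (?f z)"
          using elim(1) near r mono[of k] unfolding monotone_on_def by auto
        then show ?thesis by simp
      next
        case False
        then have "l k (?f y) - l k (?f z) \<le> \<eta>" "l k (?f z) \<le> l k (?f y)"
          using elim(1) near r mono[of k] unfolding monotone_on_def by auto
        then show ?thesis by simp
      qed
      then have "t * \<bar>l k (?f z) - l k (?f y)\<bar> \<le> t * \<eta>" using t by simp
      with expand[OF yz(1), of k] elim(3) show "l k z - l k y \<le> \<eta>'" by linarith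
    qed
  qed
  then show ?thesis unfolding osc3_def using \<epsilon>(1) by (intro exI[of _ "\<epsilon> / 6"]) auto
qed

text \<open>A plateau of positive width persists for W k near w. There the images of nearby points
  coincide, so only the error c k remains.\<close>

lemma osc3_plateau:
  assumes "fst w < 1 \<and> x = 1/3 \<or> 0 < snd w \<and> x = 2/3" "0 < \<eta>"
  shows "osc3 \<eta> x"
proof -
  \<comment> \<open>Half the distance of the plateau height from its degenerate value: W k keeps
    more than e of it, and slope 3 turns e into the radius e / 3.\<close>
  define e where "e = (if x = 1/3 then 1 - fst w else snd w) / 2"
  have e: "0 < e" "e \<le> 1/2" using assms(1) Tbar_bounds[OF w] by (auto simp: e_def)
  have c': "\<forall>\<^sub>F k in sequentially. c k < \<eta>" using c assms(2) by (rule order_tendstoD(2))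
  have "\<forall>\<^sub>F k in sequentially. \<forall>y z. third y z \<longrightarrow>
     \<bar>y - x\<bar> \<le> e / 3 \<longrightarrow> \<bar>z - x\<bar> \<le> e / 3 \<longrightarrow> l k z - l k y \<le> \<eta>"
    using dist_lim[OF e(1)] c'
  proof eventually_elim
    case (elim k)
    have d: "\<bar>fst (W k) - fst w\<bar> < e" "\<bar>snd (W k) - snd w\<bar> < e" using elim(1) by linarith+
    have const: "stunted_sawtooth (W k) y = (if x = 1/3 then fst (W k) else snd (W k))"
      if "\<bar>y - x\<bar> \<le> e / 3" for y
    proof (cases "x = 1/3")
      case True
      then have "1 - fst w = 2 * e" by (simp add: e_def)
      then have "fst (W k) < 1 - e" using d(1) by linarith
      moreover have "3 * y \<ge> 1 - e" "2 - 3 * y \<ge> 1 - e" using that True by linarith+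
      ultimately show ?thesis using True Tbar_bounds[OF W[of k]] e
        by (simp add: stunted_sawtooth_altdef[OF W])
    next
      case False
      then have "x = 2/3" using assms by auto
      then have "snd w = 2 * e" by (simp add: e_def)
      then have "snd (W k) > e" using d(2) by linarith
      moreover have "2 - 3 * y \<le> e" "3 * y - 2 \<le> e" "3 * y \<ge> 2 - e" using that \<open>x = 2/3\<close> by linarith+
      ultimately show ?thesis using False Tbar_bounds[OF W[of k]] e
        by (simp add: stunted_sawtooth_altdef[OF W])
    qed
    show ?case
    proof (intro allI impI)
      fix y z assume "third y z" "\<bar>y - x\<bar> \<le> e / 3" "\<bar>z - x\<bar> \<le> e / 3"
      with expand[OF this(1), of k] elim(2) show "l k z - l k y \<le> \<eta>" by (simp add: const)
    qed
  qed
  then show ?thesis unfolding osc3_def using e(1) by (intro exI[of _ "e / 3"]) auto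
qed

text \<open>A ratio strictly between t and 1: the excess over t absorbs the errors c k, and its
  powers still tend to 0.\<close>

lemma rate: "0 < (1 + t) / 2" "(1 + t) / 2 < 1" "0 < \<eta> \<Longrightarrow> t * \<eta> < (1 + t) / 2 * \<eta>"
proof -
  show "0 < \<eta> \<Longrightarrow> t * \<eta> < (1 + t) / 2 * \<eta>" using t by (intro mult_strict_right_mono) auto
qed (use t in auto)

lemma osc_all_iff: "(\<forall>n. osc (((1 + t) / 2) ^ n) x) \<longleftrightarrow> (\<forall>\<eta>>0. osc \<eta> x)"
proof
  assume *: "\<forall>n. osc (((1 + t) / 2) ^ n) x"
  show "\<forall>\<eta>>0. osc \<eta> x"
  proof (intro allI impI)
    fix \<eta> :: real assume "0 < \<eta>"
    then obtain n where "((1 + t) / 2) ^ n < \<eta>" using real_arch_pow_inv[OF _ rate(2)] by blast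
    with * osc_mono show "osc \<eta> x" by (meson less_imp_le)
  qed
qed (use rate(1) in auto)

text \<open>The image of x is x itself, so the gain can be iterated using information at x alone. It
  is applied at 0 and 1.\<close>

lemma osc_fixed:
  assumes "stunted_sawtooth w x = x" "x \<noteq> 1/3" "x \<noteq> 2/3" "0 < \<eta>"
  shows "osc \<eta> x"
proof -
  have "osc (((1 + t) / 2) ^ n) x" for n
  proof (induction n)
    case (Suc n)
    have "osc3 ((1 + t) / 2 * ((1 + t) / 2) ^ n) x"
      by (rule osc3_image) (use Suc assms rate rate(3)[of "((1 + t) / 2) ^ n"] in auto)
    then show ?case using osc3_regular assms by simp
  qed (simp add: osc_1)
  then show ?thesis using osc_all_iff assms(4) by blast
qed

lemma osc_turning:
  assumes "x = 1/3 \<or> x = 2/3" "0 < \<eta>"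
  shows "osc \<eta> x"
proof -
  \<comment> \<open>Half of \<eta> pays for the doubling in \<open>osc3_turning\<close>.\<close>
  have "osc3 (\<eta>/2) x"
  proof (cases "fst w < 1 \<and> x = 1/3 \<or> 0 < snd w \<and> x = 2/3")
    case True
    then show ?thesis by (rule osc3_plateau) (use assms in auto)
  next
    case False
    have "stunted_sawtooth w x = 1 \<or> stunted_sawtooth w x = 0"
      using assms(1)
    proof
      assume x: "x = 1/3"
      then have "fst w = 1" using False Tbar_bounds[OF w] by simp
      then show ?thesis unfolding x using w by simp
    next
      assume x: "x = 2/3"
      then have "snd w = 0" using False Tbar_bounds[OF w] by simp
      then show ?thesis unfolding x using w by simp
    qed
    moreover have "osc (\<eta>/2) 1" "osc (\<eta>/2) 0" by (rule osc_fixed; use w assms in simp)+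
    ultimately have "osc (\<eta>/2) (stunted_sawtooth w x)" by auto
    then show ?thesis by (rule osc3_image) (use assms t in auto)
  qed
  from osc3_turning[OF this] assms show ?thesis by simp
qed

text \<open>Asymptotic equicontinuity: near a turning point the oscillation is controlled by the plateau,
  or by the repelling fixed point onto which a degenerate plateau is mapped; elsewhere one
  iteration gains the factor \<open>t\<close>.\<close>
lemma osc_small:
  assumes "0 < \<eta>"
  shows "osc \<eta> x"
proof -
  have "osc (((1 + t) / 2) ^ n) x" for n
  proof (induction n arbitrary: x)
    case (Suc n)
    show ?case
    proof (cases "x = 1/3 \<or> x = 2/3")
      case True
      then show ?thesis by (rule osc_turning) (use rate(1) in simp)
    next
      case False
      have "osc3 ((1 + t) / 2 * ((1 + t) / 2) ^ n) x"
        by (rule osc3_image) (use Suc rate rate(3)[of "((1 + t) / 2) ^ n"] in auto)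
      then show ?thesis using osc3_regular False by simp
    qed
  qed (simp add: osc_1)
  then show ?thesis using osc_all_iff assms by blast
qed

lemma eventually_close:
  assumes "0 < e"
  shows "\<exists>\<epsilon>>0. \<forall>\<^sub>F k in sequentially. \<forall>y\<in>{0..1}. \<forall>z\<in>{0..1}.
    \<bar>y - x\<bar> \<le> \<epsilon> \<longrightarrow> \<bar>z - x\<bar> \<le> \<epsilon> \<longrightarrow> \<bar>l k z - l k y\<bar> \<le> e"
proof -
  obtain \<epsilon> where \<epsilon>: "\<epsilon> > 0" "\<forall>\<^sub>F k in sequentially. \<forall>y z. 0 \<le> y \<longrightarrow> y \<le> z \<longrightarrow> z \<le> 1 \<longrightarrow>
     \<bar>y - x\<bar> \<le> \<epsilon> \<longrightarrow> \<bar>z - x\<bar> \<le> \<epsilon> \<longrightarrow> l k z - l k y \<le> e"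
    using osc_small[OF assms, of x] unfolding osc_def by blast
  have "\<forall>\<^sub>F k in sequentially. \<forall>y\<in>{0..1}. \<forall>z\<in>{0..1}.
    \<bar>y - x\<bar> \<le> \<epsilon> \<longrightarrow> \<bar>z - x\<bar> \<le> \<epsilon> \<longrightarrow> \<bar>l k z - l k y\<bar> \<le> e"
    using \<epsilon>(2)
  proof eventually_elim
    case (elim k)
    show ?case
    proof (intro ballI impI)
      fix y z :: real assume yz: "y \<in> {0..1}" "z \<in> {0..1}" "\<bar>y - x\<bar> \<le> \<epsilon>" "\<bar>z - x\<bar> \<le> \<epsilon>"
      then have "y \<le> z \<Longrightarrow> l k y \<le> l k z" "z \<le> y \<Longrightarrow> l k z \<le> l k y"
        "y \<le> z \<Longrightarrow> l k z - l k y \<le> e" "z \<le> y \<Longrightarrow> l k y - l k z \<le> e"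
        using mono[of k] elim unfolding monotone_on_def by auto
      then show "\<bar>l k z - l k y\<bar> \<le> e" by linarith
    qed
  qed
  with \<epsilon>(1) show ?thesis by blast
qed

text \<open>A diagonal subsequence converges at the rationals; equicontinuity extends this to every
  x and to moving arguments X k.\<close>

lemma ex_limit:
  "\<exists>r L. strict_mono (r :: nat \<Rightarrow> nat) \<and> (\<forall>x X. x \<in> {0..1} \<longrightarrow> (\<forall>k. X k \<in> {0..1}) \<longrightarrow> X \<longlonglongrightarrow> x \<longrightarrow>
    (\<lambda>k. l (r k) (X k)) \<longlonglongrightarrow> L x)"
proof -
  have "norm (l n x) \<le> 1" if "x \<in> \<rat> \<inter> {0..1}" for n x using range[of x n] that by auto
  moreover have "countable (\<rat> \<inter> {0..1::real})" using countable_rat by (rule countable_Int1)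
  ultimately obtain r where r: "strict_mono (r :: nat \<Rightarrow> nat)"
    "\<And>x. x \<in> \<rat> \<inter> {0..1} \<Longrightarrow> \<exists>L. (\<lambda>n. l (r n) x) \<longlonglongrightarrow> L"
    using function_convergent_subsequence[of "\<rat> \<inter> {0..1}" l 1] by metis
  have conv: "convergent (\<lambda>k. l (r k) x)" if x: "x \<in> {0..1}" for x
  proof (rule Cauchy_convergent, rule metric_CauchyI)
    fix e :: real assume e: "0 < e"
    then have "0 < e / 4" by simp
    obtain \<epsilon> where \<epsilon>: "\<epsilon> > 0" "\<forall>\<^sub>F k in sequentially. \<forall>y\<in>{0..1}. \<forall>z\<in>{0..1}.
        \<bar>y - x\<bar> \<le> \<epsilon> \<longrightarrow> \<bar>z - x\<bar> \<le> \<epsilon> \<longrightarrow> \<bar>l k z - l k y\<bar> \<le> e / 4"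
      using eventually_close[OF \<open>0 < e / 4\<close>] by blast
    have "\<exists>p. p \<in> \<rat> \<inter> {0..1} \<and> \<bar>p - x\<bar> \<le> \<epsilon>"
    proof (cases "x = 1")
      case True
      then show ?thesis using \<epsilon>(1) by (intro exI[of _ 1]) auto
    next
      case False
      then have "x < min 1 (x + \<epsilon>)" using x \<epsilon>(1) by auto
      then obtain p where "p \<in> \<rat>" "x < p" "p < min 1 (x + \<epsilon>)" using Rats_dense_in_real by blast
      then show ?thesis using x by (intro exI[of _ p]) auto
    qed
    then obtain p where p: "p \<in> \<rat> \<inter> {0..1}" "\<bar>p - x\<bar> \<le> \<epsilon>" by blast
    have ev: "\<forall>\<^sub>F k in sequentially. \<bar>l (r k) x - l (r k) p\<bar> \<le> e / 4"
      by (rule eventually_subseq[OF r(1)], use \<epsilon>(2) in eventually_elim) (use p x \<epsilon>(1) in auto)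
    obtain N where N: "\<And>k. k \<ge> N \<Longrightarrow> \<bar>l (r k) x - l (r k) p\<bar> \<le> e / 4"
      using ev unfolding eventually_sequentially by blast
    have "Cauchy (\<lambda>k. l (r k) p)" using r(2)[OF p(1)] convergent_def convergent_Cauchy by blast
    then obtain N' where N': "\<And>j k. j \<ge> N' \<Longrightarrow> k \<ge> N' \<Longrightarrow> \<bar>l (r j) p - l (r k) p\<bar> < e / 4"
      using \<open>0 < e / 4\<close> unfolding Cauchy_def dist_real_def by blast
    show "\<exists>M. \<forall>m\<ge>M. \<forall>n\<ge>M. dist (l (r m) x) (l (r n) x) < e"
    proof (intro exI[of _ "max N N'"] allI impI)
      fix m n assume "m \<ge> max N N'" "n \<ge> max N N'"
      then have "\<bar>l (r m) x - l (r m) p\<bar> \<le> e / 4" "\<bar>l (r n) x - l (r n) p\<bar> \<le> e / 4"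
        "\<bar>l (r m) p - l (r n) p\<bar> < e / 4" using N N' by auto
      with e show "dist (l (r m) x) (l (r n) x) < e" unfolding dist_real_def abs_le_iff abs_less_iff by (elim conjE, intro conjI; linarith)
    qed
  qed
  define L where "L x = lim (\<lambda>k. l (r k) x)" for x
  have "(\<lambda>k. l (r k) (X k)) \<longlonglongrightarrow> L x" if x: "x \<in> {0..1}" "\<forall>k. X k \<in> {0..1}" "X \<longlonglongrightarrow> x" for x X
  proof -
    have "(\<lambda>k. l (r k) (X k) - l (r k) x) \<longlonglongrightarrow> 0"
    proof (rule tendstoI)
      fix e :: real assume e: "0 < e"
      then have "0 < e / 2" by simp
      obtain \<epsilon> where \<epsilon>: "\<epsilon> > 0" "\<forall>\<^sub>F k in sequentially. \<forall>y\<in>{0..1}. \<forall>z\<in>{0..1}.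
          \<bar>y - x\<bar> \<le> \<epsilon> \<longrightarrow> \<bar>z - x\<bar> \<le> \<epsilon> \<longrightarrow> \<bar>l k z - l k y\<bar> \<le> e / 2"
        using eventually_close[OF \<open>0 < e / 2\<close>] by blast
      have "\<forall>\<^sub>F k in sequentially. dist (X k) x < \<epsilon>" using tendstoD[OF x(3) \<epsilon>(1)] .
      then show "\<forall>\<^sub>F k in sequentially. dist (l (r k) (X k) - l (r k) x) 0 < e"
        using eventually_subseq[OF r(1) \<epsilon>(2)]
      proof eventually_elim
        case (elim k)
        have "\<bar>l (r k) (X k) - l (r k) x\<bar> \<le> e / 2"
          using elim(1) x \<epsilon>(1) by (intro elim(2)[rule_format]) (auto simp: dist_real_def)
        then show ?case using e by (simp add: dist_real_def)
      qed
    qed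
    moreover have "(\<lambda>k. l (r k) x) \<longlonglongrightarrow> L x"
      unfolding L_def using conv[OF x(1)] by (simp add: convergent_LIMSEQ_iff)
    ultimately show ?thesis using tendsto_add by fastforce
  qed
  with r(1) show ?thesis by blast
qed

end

section \<open>Weighted sums and their normalised limits\<close>

definition wsum :: "real \<times> real \<Rightarrow> real \<Rightarrow> nat \<Rightarrow> real \<Rightarrow> real" where
  "wsum w t N x = (\<Sum>n<N. t ^ n * fvar w crossing n x)"

lemma wsum_0 [simp]: "w \<in> Tbar \<Longrightarrow> wsum w t N 0 = 0"
  by (simp add: wsum_def)

lemma wsum_le:
  assumes "w \<in> Tbar" "0 \<le> t" "0 \<le> x" "x \<le> y" "y \<le> 1"
  shows "wsum w t N x \<le> wsum w t N y"
  unfolding wsum_def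
  by (intro sum_mono mult_left_mono fvar_le mono_crossing zero_le_power assms)

lemma fvar_crossing_nonneg: "w \<in> Tbar \<Longrightarrow> 0 \<le> x \<Longrightarrow> x \<le> 1 \<Longrightarrow> 0 \<le> fvar w crossing n x"
  using fvar_le[OF _ mono_crossing, of w 0 x n] by simp

lemma abs_wsum_diff:
  assumes "w \<in> Tbar" "0 \<le> t" "x \<in> {0..1}" "y \<in> {0..1}"
  shows "\<bar>wsum w t N y - wsum w t N x\<bar> = (\<Sum>n<N. t ^ n * \<bar>fvar w crossing n y - fvar w crossing n x\<bar>)"
proof -
  have *: "\<bar>wsum w t N y - wsum w t N x\<bar> = (\<Sum>n<N. t ^ n * \<bar>fvar w crossing n y - fvar w crossing n x\<bar>)"
    if "x \<le> y" "x \<in> {0..1}" "y \<in> {0..1}" for x y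
  proof -
    have "wsum w t N x \<le> wsum w t N y" using wsum_le assms that by auto
    then have "\<bar>wsum w t N y - wsum w t N x\<bar> = wsum w t N y - wsum w t N x" by simp
    also have "\<dots> = (\<Sum>n<N. t ^ n * (fvar w crossing n y - fvar w crossing n x))"
      unfolding wsum_def by (simp add: sum_subtractf right_diff_distrib)
    also have "\<dots> = (\<Sum>n<N. t ^ n * \<bar>fvar w crossing n y - fvar w crossing n x\<bar>)"
    proof (intro sum.cong refl)
      fix n
      have "fvar w crossing n x \<le> fvar w crossing n y"
        using fvar_le[OF assms(1) mono_crossing] that by auto
      then show "t ^ n * (fvar w crossing n y - fvar w crossing n x) =
          t ^ n * \<bar>fvar w crossing n y - fvar w crossing n x\<bar>" by simp
    qed
    finally show ?thesis .
  qed
  show ?thesis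
  proof (cases "x \<le> y")
    case False
    then show ?thesis using *[of y x] assms by (simp add: abs_minus_commute)
  qed (use * assms in auto)
qed

text \<open>The source of the eigenvalue equation: splitting off the term n = 0 leaves t times a sum
  at the images that is one term shorter. The defects are the crossing jump, at most 2, and the
  missing last term.\<close>

lemma wsum_third:
  assumes w: "w \<in> Tbar" and t: "0 \<le> t" and xy: "third x y"
  shows "wsum w t (Suc N) y - wsum w t (Suc N) x = crossing y - crossing x
    + t * \<bar>wsum w t N (stunted_sawtooth w y) - wsum w t N (stunted_sawtooth w x)\<bar>"
proof -
  have r: "stunted_sawtooth w x \<in> {0..1}" "stunted_sawtooth w y \<in> {0..1}"
    using stunted_sawtooth_range[OF w] third_01[OF xy] by auto
  have "wsum w t (Suc N) y - wsum w t (Suc N) x =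
      (\<Sum>n<Suc N. t ^ n * (fvar w crossing n y - fvar w crossing n x))"
    unfolding wsum_def by (simp only: sum_subtractf right_diff_distrib)
  also have "\<dots> = crossing y - crossing x +
      (\<Sum>n<N. t ^ Suc n * (fvar w crossing (Suc n) y - fvar w crossing (Suc n) x))"
    by (subst sum.lessThan_Suc_shift) simp
  also have "(\<Sum>n<N. t ^ Suc n * (fvar w crossing (Suc n) y - fvar w crossing (Suc n) x)) =
      t * (\<Sum>n<N. t ^ n * \<bar>fvar w crossing n (stunted_sawtooth w y) - fvar w crossing n (stunted_sawtooth w x)\<bar>)"
    by (simp add: fvar_third[OF w xy w mono_crossing] sum_distrib_left mult.assoc)
  finally show ?thesis unfolding abs_wsum_diff[OF w t r] .
qed

text \<open>Restoring the missing term is free for the upper estimate, as all terms are nonnegative;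
  for the lower one it costs the last term, which has to be controlled separately.\<close>

lemma abs_wsum_Suc:
  assumes "w \<in> Tbar" "0 \<le> t" "x \<in> {0..1}" "y \<in> {0..1}"
  shows "\<bar>wsum w t N y - wsum w t N x\<bar> \<le> \<bar>wsum w t (Suc N) y - wsum w t (Suc N) x\<bar>"
    and "\<bar>wsum w t (Suc N) y - wsum w t (Suc N) x\<bar> \<le>
      \<bar>wsum w t N y - wsum w t N x\<bar> + t ^ N * fvar w crossing N 1"
proof -
  have "0 \<le> fvar w crossing N x" "fvar w crossing N x \<le> fvar w crossing N 1"
    "0 \<le> fvar w crossing N y" "fvar w crossing N y \<le> fvar w crossing N 1"
    using fvar_crossing_nonneg[OF assms(1)] fvar_le[OF assms(1) mono_crossing] assms(3,4) by auto
  then have "\<bar>fvar w crossing N y - fvar w crossing N x\<bar> \<le> fvar w crossing N 1" by linarith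
  then have "t ^ N * \<bar>fvar w crossing N y - fvar w crossing N x\<bar> \<le> t ^ N * fvar w crossing N 1"
    using assms(2) by (intro mult_left_mono) auto
  moreover have "0 \<le> t ^ N * \<bar>fvar w crossing N y - fvar w crossing N x\<bar>" using assms(2) by simp
  ultimately show "\<bar>wsum w t N y - wsum w t N x\<bar> \<le> \<bar>wsum w t (Suc N) y - wsum w t (Suc N) x\<bar>"
    "\<bar>wsum w t (Suc N) y - wsum w t (Suc N) x\<bar> \<le>
      \<bar>wsum w t N y - wsum w t N x\<bar> + t ^ N * fvar w crossing N 1"
    unfolding abs_wsum_diff[OF assms] by simp_all
qed

text \<open>Normalised partial sums of \<open>\<Sum>n. t ^ n * fvar (W k) crossing n\<close> approximate a function on
  which the limit map expands by the factor \<open>1 / t\<close> on each third.\<close>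

lemma normalized_limit:
  fixes M :: "nat \<Rightarrow> nat"
  assumes w: "w \<in> Tbar" and W: "\<And>k. W k \<in> Tbar" and lim: "W \<longlonglongrightarrow> w"
    and t: "0 < t" "t < 1" and large: "\<And>k. real k + 1 \<le> wsum (W k) t (Suc (M k)) 1"
  obtains L where "mono_on {0..1} L" "L 0 = 0" "L 1 = 1"
    "\<And>x y. third x y \<Longrightarrow> L y - L x \<le> t * \<bar>L (stunted_sawtooth w y) - L (stunted_sawtooth w x)\<bar>"
    "\<And>x y. \<lbrakk>\<And>k. t ^ M k * fvar (W k) crossing (M k) 1 \<le> 1; third x y\<rbrakk> \<Longrightarrow>
      t * \<bar>L (stunted_sawtooth w y) - L (stunted_sawtooth w x)\<bar> \<le> L y - L x"
proof -
  define D where "D k = wsum (W k) t (Suc (M k)) 1" for k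
  define l where "l k x = wsum (W k) t (Suc (M k)) x / D k" for k x
  \<comment> \<open>Dominates 2 / D k, which covers the normalised crossing jump and, in the lower
    estimate, the truncated last term.\<close>
  define c where "c k = 2 / (real k + 1)" for k
  have D: "real k + 1 \<le> D k" "0 < D k" for k using large[of k] unfolding D_def by auto
  have "(\<lambda>k. 2 * inverse (real (Suc k))) \<longlonglongrightarrow> 2 * 0"
    by (intro tendsto_mult tendsto_const LIMSEQ_inverse_real_of_nat)
  then have c: "c \<longlonglongrightarrow> 0" unfolding c_def by (simp add: field_simps)
  have c_ge: "2 / D k \<le> c k" for k
    unfolding c_def using D[of k] by (intro divide_left_mono) auto
  have l_mono: "l k x \<le> l k y" if "0 \<le> x" "x \<le> y" "y \<le> 1" for k x y
    unfolding l_def using wsum_le[OF W _ that, of t k] t D(2)[of k] by (simp add: divide_right_mono)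
  have l0: "l k 0 = 0" for k unfolding l_def using W by simp
  have l1: "l k 1 = 1" for k unfolding l_def using D(2)[of k] by (simp add: D_def)
  have l_diff: "\<bar>l k y - l k x\<bar> = \<bar>wsum (W k) t (Suc (M k)) y - wsum (W k) t (Suc (M k)) x\<bar> / D k" for k x y
    unfolding l_def using D(2)[of k] by (simp add: diff_divide_distrib[symmetric] abs_divide)
  have upper: "l k y - l k x \<le> c k + t * \<bar>l k (stunted_sawtooth (W k) y) - l k (stunted_sawtooth (W k) x)\<bar>"
    and lower: "(\<And>k. t ^ M k * fvar (W k) crossing (M k) 1 \<le> 1) \<Longrightarrow>
      t * \<bar>l k (stunted_sawtooth (W k) y) - l k (stunted_sawtooth (W k) x)\<bar> \<le> l k y - l k x + c k"
    if xy: "third x y" for k x y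
  proof -
    let ?p = "stunted_sawtooth (W k) x" and ?q = "stunted_sawtooth (W k) y"
    have r: "?p \<in> {0..1}" "?q \<in> {0..1}" using stunted_sawtooth_range[OF W] third_01[OF xy] by auto
    have eq: "l k y - l k x = (crossing y - crossing x + t * \<bar>wsum (W k) t (M k) ?q - wsum (W k) t (M k) ?p\<bar>) / D k"
      unfolding wsum_third[OF W less_imp_le[OF t(1)] xy, symmetric] l_def by (simp add: diff_divide_distrib)
    have cr: "0 \<le> crossing y - crossing x" "crossing y - crossing x \<le> 2"
      using mono_crossing[of UNIV] third_01[OF xy] crossing_bounds[of x] crossing_bounds[of y]
      unfolding monotone_on_def by auto
    have "l k y - l k x \<le> (2 + t * \<bar>wsum (W k) t (Suc (M k)) ?q - wsum (W k) t (Suc (M k)) ?p\<bar>) / D k"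
      unfolding eq using cr(2) abs_wsum_Suc(1)[OF W less_imp_le[OF t(1)] r, of k "M k"] t D(2)[of k]
      by (intro divide_right_mono add_mono mult_left_mono) auto
    also have "\<dots> = 2 / D k + t * \<bar>l k ?q - l k ?p\<bar>" by (simp add: l_diff add_divide_distrib)
    finally show "l k y - l k x \<le> c k + t * \<bar>l k ?q - l k ?p\<bar>" using c_ge[of k] by linarith
    assume small: "\<And>k. t ^ M k * fvar (W k) crossing (M k) 1 \<le> 1"
    have "t * \<bar>l k ?q - l k ?p\<bar> = t * \<bar>wsum (W k) t (Suc (M k)) ?q - wsum (W k) t (Suc (M k)) ?p\<bar> / D k"
      by (simp add: l_diff)
    also have "\<dots> \<le> t * (\<bar>wsum (W k) t (M k) ?q - wsum (W k) t (M k) ?p\<bar> + 1) / D k"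
      using abs_wsum_Suc(2)[OF W less_imp_le[OF t(1)] r, of k "M k"] t D(2)[of k] small[of k]
      by (intro divide_right_mono mult_left_mono) auto
    also have "\<dots> \<le> (crossing y - crossing x + t * \<bar>wsum (W k) t (M k) ?q - wsum (W k) t (M k) ?p\<bar> + 2) / D k"
      using cr(1) t D(2)[of k] by (intro divide_right_mono) (auto simp: distrib_left)
    also have "\<dots> = l k y - l k x + 2 / D k" unfolding eq by (simp add: add_divide_distrib)
    finally show "t * \<bar>l k ?q - l k ?p\<bar> \<le> l k y - l k x + c k" using c_ge[of k] by linarith
  qed
  interpret expanding_limit W w c t l
  proof
    show "mono_on {0..1} (l k)" for k by (intro monotone_onI) (auto intro: l_mono)
    show "l k x \<in> {0..1}" if "x \<in> {0..1}" for k x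
      using l_mono[of 0 x k] l_mono[of x 1 k] that l0 l1 by auto
  qed (use w W lim t c upper in auto)
  obtain r L where r: "strict_mono (r :: nat \<Rightarrow> nat)" and L: "\<And>x X. x \<in> {0..1} \<Longrightarrow> (\<And>k. X k \<in> {0..1}) \<Longrightarrow>
      X \<longlonglongrightarrow> x \<Longrightarrow> (\<lambda>k. l (r k) (X k)) \<longlonglongrightarrow> L x"
    using ex_limit by metis
  have Lc: "(\<lambda>k. l (r k) x) \<longlonglongrightarrow> L x" if "x \<in> {0..1}" for x
    by (rule L) (use that in auto)
  have f: "(\<lambda>k. stunted_sawtooth (W (r k)) x) \<longlonglongrightarrow> stunted_sawtooth w x" for x
    by (rule stunted_sawtooth_tendsto[OF w _ _ tendsto_const])
      (use W LIMSEQ_subseq_LIMSEQ[OF lim r] in \<open>auto simp: o_def\<close>)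
  have Lf: "(\<lambda>k. l (r k) (stunted_sawtooth (W (r k)) x)) \<longlonglongrightarrow> L (stunted_sawtooth w x)"
    if "0 \<le> x" "x \<le> 1" for x
    by (rule L[OF _ _ f]) (use that stunted_sawtooth_range w W in auto)
  have cr: "(\<lambda>k. c (r k)) \<longlonglongrightarrow> 0" using LIMSEQ_subseq_LIMSEQ[OF c r] by (simp add: o_def)
  have right: "(\<lambda>k. t * \<bar>l (r k) (stunted_sawtooth (W (r k)) y) - l (r k) (stunted_sawtooth (W (r k)) x)\<bar>)
      \<longlonglongrightarrow> t * \<bar>L (stunted_sawtooth w y) - L (stunted_sawtooth w x)\<bar>"
    and left: "(\<lambda>k. l (r k) y - l (r k) x) \<longlonglongrightarrow> L y - L x"
    if "third x y" for x y
    using third_01[OF that] by (intro tendsto_intros Lf Lc; auto)+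
  show ?thesis
  proof
    show "mono_on {0..1} L"
    proof (rule monotone_onI)
      fix x y :: real assume "x \<in> {0..1}" "y \<in> {0..1}" "x \<le> y"
      then show "L x \<le> L y"
        by (intro LIMSEQ_le[OF Lc Lc]) (auto intro: l_mono)
    qed
    show "L 0 = 0" using LIMSEQ_unique[OF Lc[of 0]] l0 by auto
    show "L 1 = 1" using LIMSEQ_unique[OF Lc[of 1]] l1 by auto
    fix x y :: real assume xy: "third x y"
    show "L y - L x \<le> t * \<bar>L (stunted_sawtooth w y) - L (stunted_sawtooth w x)\<bar>"
      using LIMSEQ_le[OF left[OF xy] tendsto_add[OF cr right[OF xy]]] upper[OF xy] by auto
    assume small: "\<And>k. t ^ M k * fvar (W k) crossing (M k) 1 \<le> 1"
    show "t * \<bar>L (stunted_sawtooth w y) - L (stunted_sawtooth w x)\<bar> \<le> L y - L x"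
      using LIMSEQ_le[OF right[OF xy] tendsto_add[OF left[OF xy] cr]] lower[OF xy small] by auto
  qed
qed

text \<open>The divergence is assumed along W, but the limit L is expanded by the map for w itself.
  The constant sequence relates lap numbers to the series at w; a varying one gives upper
  semicontinuity.\<close>

lemma laps_ge_power:
  assumes w: "w \<in> Tbar" and W: "\<And>k. W k \<in> Tbar" and lim: "W \<longlonglongrightarrow> w"
    and "1 < \<tau>" and unbounded: "\<And>k B. \<exists>N. B < wsum (W k) (1 / \<tau>) N 1"
  shows "\<tau> ^ n \<le> real (laps (stunted_sawtooth w ^^ n))"
proof -
  have "\<exists>M. real k + 1 \<le> wsum (W k) (1 / \<tau>) (Suc M) 1" for k
  proof -
    obtain N where N: "real k + 1 < wsum (W k) (1 / \<tau>) N 1" using unbounded by blast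
    then obtain M where "N = Suc M" by (cases N) (auto simp: wsum_def)
    with N show ?thesis by (intro exI[of _ M]) simp
  qed
  then obtain M where M: "\<And>k. real k + 1 \<le> wsum (W k) (1 / \<tau>) (Suc (M k)) 1" by metis
  have t: "0 < 1 / \<tau>" "1 / \<tau> < 1" using \<open>1 < \<tau>\<close> by auto
  obtain L where L: "mono_on {0..1} L" "L 0 = 0" "L 1 = 1"
    "\<And>x y. third x y \<Longrightarrow> L y - L x \<le> 1 / \<tau> * \<bar>L (stunted_sawtooth w y) - L (stunted_sawtooth w x)\<bar>"
    by (rule normalized_limit[OF w W lim t M], blast)
  have "\<tau> ^ n * L 1 - \<tau> ^ n * L 0 \<le> real (laps (stunted_sawtooth w ^^ n)) * (\<tau> ^ 0 * L 1 - \<tau> ^ 0 * L 0)"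
  proof (rule lap_growth[OF w])
    show "mono_on {0..1} (\<lambda>x. \<tau> ^ n * L x)" for n
      using L(1) \<open>1 < \<tau>\<close> unfolding monotone_on_def by (auto intro: mult_left_mono)
    fix n x y assume "third x y"
    from L(4)[OF this] have "\<tau> ^ Suc n * (L y - L x) \<le> \<tau> ^ Suc n * (1 / \<tau> * \<bar>L (stunted_sawtooth w y) - L (stunted_sawtooth w x)\<bar>)"
      using \<open>1 < \<tau>\<close> by (intro mult_left_mono) auto
    also have "\<dots> = \<bar>\<tau> ^ n * (L (stunted_sawtooth w y) - L (stunted_sawtooth w x))\<bar>"
      using \<open>1 < \<tau>\<close> by (simp add: abs_mult)
    finally show "\<tau> ^ Suc n * L y - \<tau> ^ Suc n * L x \<le>
        \<bar>\<tau> ^ n * L (stunted_sawtooth w y) - \<tau> ^ n * L (stunted_sawtooth w x)\<bar>"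
      by (simp add: right_diff_distrib)
  qed
  then show ?thesis using L by simp
qed

section \<open>Growth rate and entropy\<close>

text \<open>The infimum exists at once and yields \<open>growth_power_le\<close> for every n; that
  it is the limit exp h is shown in \<open>top_entropy_eq\<close>. \<open>Suc n\<close> avoids the
  zeroth root.\<close>

definition growth :: "real \<times> real \<Rightarrow> real" where
  "growth w = (INF n. root (Suc n) (real (laps (stunted_sawtooth w ^^ Suc n))))"

lemma growth_bdd: "bdd_below (range (\<lambda>n. root (Suc n) (real (laps (stunted_sawtooth w ^^ Suc n)))))"
  by (intro bdd_belowI[of _ 0]) (auto simp del: funpow.simps)

lemma growth_ge:
  assumes "0 \<le> \<tau>" "\<And>n. \<tau> ^ n \<le> real (laps (stunted_sawtooth w ^^ n))"
  shows "\<tau> \<le> growth w"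
  unfolding growth_def
proof (rule cINF_greatest)
  fix n
  have "\<tau> = root (Suc n) (\<tau> ^ Suc n)" using assms(1) by (simp only: real_root_power_cancel zero_less_Suc)
  also have "\<dots> \<le> root (Suc n) (real (laps (stunted_sawtooth w ^^ Suc n)))"
    using assms(2) by (simp only: real_root_le_iff zero_less_Suc)
  finally show "\<tau> \<le> root (Suc n) (real (laps (stunted_sawtooth w ^^ Suc n)))" .
qed simp

lemma growth_ge_1: "w \<in> Tbar \<Longrightarrow> 1 \<le> growth w"
  using laps_ge_1 by (intro growth_ge) auto

lemma growth_power_le:
  assumes "w \<in> Tbar"
  shows "growth w ^ n \<le> real (laps (stunted_sawtooth w ^^ n))"
proof (cases n)
  case 0
  then show ?thesis using laps_ge_1[OF assms, of 0] by simp
next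
  case (Suc m)
  have "growth w \<le> root (Suc m) (real (laps (stunted_sawtooth w ^^ Suc m)))"
    unfolding growth_def by (rule cINF_lower[OF growth_bdd]) simp
  then have "growth w ^ Suc m \<le> root (Suc m) (real (laps (stunted_sawtooth w ^^ Suc m))) ^ Suc m"
    using growth_ge_1[OF assms] by (intro power_mono) auto
  also have "\<dots> = real (laps (stunted_sawtooth w ^^ Suc m))"
    by (rule real_root_pow_pos2) auto
  finally show ?thesis using Suc by simp
qed

text \<open>Summing n bounds on v(i) costs a factor n, which a slightly larger base absorbs.\<close>

lemma linear_le_exponential:
  fixes \<tau> \<tau>' C :: real
  assumes "0 < \<tau>" "\<tau> < \<tau>'" "1 \<le> \<tau>'" "0 \<le> C"
  obtains B where "0 < B" "\<And>n. 1 + real n * C * \<tau> ^ n \<le> B * \<tau>' ^ n"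
proof -
  have "(\<lambda>n. of_nat n * (\<tau> / \<tau>') ^ n) \<longlonglongrightarrow> 0"
    by (rule powser_times_n_limit_0) (use assms in auto)
  then have "Bseq (\<lambda>n. of_nat n * (\<tau> / \<tau>') ^ n)" by (intro convergent_imp_Bseq convergentI)
  then obtain K where K: "0 < K" "\<And>n. norm (real n * (\<tau> / \<tau>') ^ n) \<le> K" by (elim BseqE) auto
  show ?thesis
  proof
    show "0 < 1 + C * K" using K assms by (intro add_pos_nonneg) auto
    fix n
    have "real n * \<tau> ^ n = real n * (\<tau> / \<tau>') ^ n * \<tau>' ^ n" using assms by (simp add: power_divide)
    also have "\<dots> \<le> K * \<tau>' ^ n" using K(2)[of n] assms by (intro mult_right_mono) auto
    finally have "C * (real n * \<tau> ^ n) \<le> C * (K * \<tau>' ^ n)" using assms by (intro mult_left_mono) auto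
    moreover have "1 \<le> \<tau>' ^ n" using assms by simp
    ultimately show "1 + real n * C * \<tau> ^ n \<le> (1 + C * K) * \<tau>' ^ n"
      by (simp add: algebra_simps)
  qed
qed

lemma laps_le_of_fvar:
  assumes w: "w \<in> Tbar" and "1 \<le> \<tau>" "0 \<le> C" and v: "\<And>i. fvar w crossing i 1 \<le> C * \<tau> ^ i"
  shows "real (laps (stunted_sawtooth w ^^ n)) \<le> 1 + real n * C * \<tau> ^ n"
proof -
  have "(\<Sum>i<n. fvar w crossing i 1) \<le> (\<Sum>i<n. C * \<tau> ^ n)"
  proof (rule sum_mono)
    fix i assume "i \<in> {..<n}"
    then have "\<tau> ^ i \<le> \<tau> ^ n" using assms by (intro power_increasing) auto
    then show "fvar w crossing i 1 \<le> C * \<tau> ^ n" using v[of i] mult_left_mono[OF _ assms(3)] order.trans by blast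
  qed
  then show ?thesis using laps_le_sum_fvar[OF w, of n] by simp
qed

lemma le_of_power_le:
  fixes g \<tau> B :: real
  assumes "0 < \<tau>" "0 < B" "\<And>n. g ^ n \<le> B * \<tau> ^ n"
  shows "g \<le> \<tau>"
proof (rule ccontr)
  assume "\<not> g \<le> \<tau>"
  then have "1 < g / \<tau>" using assms(1) by simp
  then obtain n where "B < (g / \<tau>) ^ n" using real_arch_pow by blast
  then show False using assms(1) assms(3)[of n] by (simp add: power_divide field_simps)
qed

lemma growth_le_of_fvar:
  assumes w: "w \<in> Tbar" and "1 \<le> \<tau>" "0 \<le> C" and v: "\<And>i. fvar w crossing i 1 \<le> C * \<tau> ^ i"
  shows "growth w \<le> \<tau>"
proof (rule dense_ge)
  fix \<tau>' assume "\<tau> < \<tau>'"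
  obtain B where B: "0 < B" "\<And>n. 1 + real n * C * \<tau> ^ n \<le> B * \<tau>' ^ n"
    using linear_le_exponential[of \<tau> \<tau>' C] \<open>\<tau> < \<tau>'\<close> assms by auto
  show "growth w \<le> \<tau>'"
  proof (rule le_of_power_le[OF _ B(1)])
    show "growth w ^ n \<le> B * \<tau>' ^ n" for n
      using growth_power_le[OF w, of n] laps_le_of_fvar[OF assms, of n] B(2)[of n] by linarith
  qed (use \<open>\<tau> < \<tau>'\<close> assms in auto)
qed

lemma fvar_le_of_wsum:
  assumes w: "w \<in> Tbar" and "0 < \<tau>" and B: "\<And>N. wsum w (1 / \<tau>) N 1 \<le> B"
  shows "fvar w crossing i 1 \<le> B * \<tau> ^ i"
proof -
  have "(1 / \<tau>) ^ i * fvar w crossing i 1 \<le> wsum w (1 / \<tau>) (Suc i) 1"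
    unfolding wsum_def using \<open>0 < \<tau>\<close> fvar_crossing_nonneg[OF w]
    by (intro member_le_sum) auto
  also have "\<dots> \<le> B" by (rule B)
  finally show ?thesis using \<open>0 < \<tau>\<close> by (simp add: power_one_over field_simps)
qed

text \<open>Unbounded sums would give laps >= \<tau>^n by \<open>laps_ge_power\<close> along the
  constant sequence w.\<close>

lemma wsum_bounded_of_growth:
  assumes w: "w \<in> Tbar" and "growth w < \<tau>"
  shows "\<exists>B\<ge>0. \<forall>N. wsum w (1 / \<tau>) N 1 \<le> B"
proof (rule ccontr)
  assume *: "\<not> (\<exists>B\<ge>0. \<forall>N. wsum w (1 / \<tau>) N 1 \<le> B)"
  have "\<exists>N. B < wsum w (1 / \<tau>) N 1" for B
    using *[unfolded not_ex, rule_format, of "max 0 B"] by (auto simp: not_le)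
  then have "\<tau> ^ n \<le> real (laps (stunted_sawtooth w ^^ n))" for n
    using assms growth_ge_1[OF w] by (intro laps_ge_power[OF w, of "\<lambda>_. w"]) auto
  then have "\<tau> \<le> growth w" using assms growth_ge_1[OF w] by (intro growth_ge) auto
  with assms show False by simp
qed

lemma fvar_le_of_growth:
  assumes w: "w \<in> Tbar" and "growth w < \<tau>"
  shows "\<exists>B\<ge>0. \<forall>i. fvar w crossing i 1 \<le> B * \<tau> ^ i"
proof -
  obtain B where "0 \<le> B" "\<And>N. wsum w (1 / \<tau>) N 1 \<le> B"
    using wsum_bounded_of_growth[OF assms] by blast
  moreover have "0 < \<tau>" using growth_ge_1[OF w] assms(2) by simp
  ultimately show ?thesis using fvar_le_of_wsum[OF w] by blast
qed

lemma wsum_unbounded_of_growth: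
  assumes w: "w \<in> Tbar" and "1 \<le> \<tau>" "\<tau> < growth w"
  shows "\<exists>N. B < wsum w (1 / \<tau>) N 1"
proof (rule ccontr)
  assume "\<nexists>N. B < wsum w (1 / \<tau>) N 1"
  then have *: "wsum w (1 / \<tau>) N 1 \<le> max 0 B" for N by (auto simp: not_less le_max_iff_disj)
  have "growth w \<le> \<tau>"
    by (rule growth_le_of_fvar[OF w assms(2) _ fvar_le_of_wsum[OF w _ *]]) (use assms in auto)
  with assms show False by simp
qed

lemma top_entropy_eq:
  assumes w: "w \<in> Tbar"
  shows "top_entropy (stunted_sawtooth w) = ln (growth w)"
proof -
  let ?g = "growth w"
  let ?h = "\<lambda>n. ln (real (laps (stunted_sawtooth w ^^ n))) / real n"
  have g: "1 \<le> ?g" using growth_ge_1[OF w] .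
  have pos: "0 < real (laps (stunted_sawtooth w ^^ n))" for n using laps_ge_1[OF w, of n] by simp
  have "?h \<longlonglongrightarrow> ln ?g"
  proof (rule order_tendstoI)
    fix a assume "a < ln ?g"
    have lower: "ln ?g \<le> ?h n" if "0 < n" for n
    proof -
      have "ln (?g ^ n) \<le> ln (real (laps (stunted_sawtooth w ^^ n)))"
        using growth_power_le[OF w, of n] g pos[of n] by (subst ln_le_cancel_iff) auto
      then show ?thesis using g that by (simp add: ln_realpow field_simps)
    qed
    show "\<forall>\<^sub>F n in sequentially. a < ?h n"
      using eventually_gt_at_top[of 0]
      by eventually_elim (rule less_le_trans[OF \<open>a < ln ?g\<close> lower])
  next
    fix a assume a: "ln ?g < a"
    define b where "b = (ln ?g + a) / 2"
    have b: "ln ?g < b" "b < a" using a by (auto simp: b_def)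
    \<comment> \<open>Strict gaps on both sides: the one above the growth rate bounds the v(i), the
      one below exp b absorbs the factor n.\<close>
    define \<tau> where "\<tau> = (?g + exp b) / 2"
    have "exp (ln ?g) < exp b" using b(1) by (simp only: exp_less_cancel_iff)
    then have "?g < exp b" using g by simp
    then have \<tau>: "?g < \<tau>" "\<tau> < exp b" by (auto simp: \<tau>_def)
    obtain C where C: "0 \<le> C" "\<And>i. fvar w crossing i 1 \<le> C * \<tau> ^ i"
      using fvar_le_of_growth[OF w \<tau>(1)] by blast
    obtain B where B: "0 < B" "\<And>n. 1 + real n * C * \<tau> ^ n \<le> B * exp b ^ n"
    proof -
      have "0 < \<tau>" "1 \<le> exp b" using \<tau> g by linarith+
      from linear_le_exponential[OF this(1) \<tau>(2) this(2) C(1)] that show thesis by blast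
    qed
    have bound: "?h n \<le> ln B / real n + b" if "0 < n" for n
    proof -
      have "real (laps (stunted_sawtooth w ^^ n)) \<le> B * exp b ^ n"
        using laps_le_of_fvar[OF w _ C, of n] B(2)[of n] \<tau> g by simp
      then have "ln (real (laps (stunted_sawtooth w ^^ n))) \<le> ln (B * exp b ^ n)"
        using pos[of n] B(1) by (subst ln_le_cancel_iff) auto
      also have "\<dots> = ln B + real n * b" using B(1) by (simp add: ln_mult ln_realpow)
      finally show ?thesis using that by (simp add: field_simps)
    qed
    have "(\<lambda>n. ln B / real n + b) \<longlonglongrightarrow> 0 + b"
      by (intro tendsto_add tendsto_const lim_const_over_n)
    then have "\<forall>\<^sub>F n in sequentially. ln B / real n + b < a"
      using b(2) by (intro order_tendstoD(2)) auto
    then show "\<forall>\<^sub>F n in sequentially. ?h n < a"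
      using eventually_gt_at_top[of 0] by eventually_elim (rule le_less_trans[OF bound])
  qed
  then show ?thesis unfolding top_entropy_def by (rule limI)
qed

section \<open>The kneading determinant\<close>

text \<open>If \<open>S_w\<close> expands \<open>L\<close> exactly by \<open>1 / t\<close> on each third and \<open>L 0 = 0\<close>, then
  \<open>L x = t * (slope_sign x * L (S_w x) + \<alpha> * L (fst w) + \<beta> * L (snd w))\<close> with
  \<open>(\<alpha>, \<beta>) = (0, 0), (2, 0), (2, -2)\<close> on the three thirds. The coefficients below arise by
  iterating this identity along the orbit of \<open>x\<close>.\<close>

definition slope_sign :: "real \<Rightarrow> real" where
  "slope_sign x = (if 1/3 < x \<and> x \<le> 2/3 then -1 else 1)"

definition top_coeff :: "real \<times> real \<Rightarrow> real \<Rightarrow> nat \<Rightarrow> real" where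
  "top_coeff w x n = (\<Prod>i<n. slope_sign ((stunted_sawtooth w ^^ i) x)) *
    (if (stunted_sawtooth w ^^ n) x \<le> 1/3 then 0 else 2)"

definition bot_coeff :: "real \<times> real \<Rightarrow> real \<Rightarrow> nat \<Rightarrow> real" where
  "bot_coeff w x n = (\<Prod>i<n. slope_sign ((stunted_sawtooth w ^^ i) x)) *
    (if (stunted_sawtooth w ^^ n) x \<le> 2/3 then 0 else -2)"

text \<open>The outer factor z reflects the factor t of the identity and gives the value 0 at 0,
  hence determinant 1 there. The argument is complex for the sake of analytic continuation.\<close>

definition kneading :: "(nat \<Rightarrow> real) \<Rightarrow> complex \<Rightarrow> complex" where
  "kneading a z = z * (\<Sum>n. of_real (a n) * z ^ n)"

lemma abs_prod_slope_sign:
  fixes n :: nat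
  shows "\<bar>\<Prod>i<n. slope_sign (g i)\<bar> = 1"
  by (induction n) (auto simp: abs_mult slope_sign_def)

lemma coeff_bounds: "\<bar>top_coeff w x n\<bar> \<le> 2" "\<bar>bot_coeff w x n\<bar> \<le> 2"
  by (auto simp: top_coeff_def bot_coeff_def abs_mult abs_prod_slope_sign)

lemma kneading_summable:
  assumes "\<And>n. \<bar>a n\<bar> \<le> 2" "norm (z :: complex) < 1"
  shows "summable (\<lambda>n. of_real (a n) * z ^ n)"
proof (rule summable_comparison_test')
  show "summable (\<lambda>n. 2 * norm z ^ n)" using assms(2) by (intro summable_mult summable_geometric) auto
  show "norm (of_real (a n) * z ^ n) \<le> 2 * norm z ^ n" for n
    using assms(1) by (simp add: norm_mult norm_power mult_right_mono)
qed

lemma kneading_holomorphic: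
  assumes "\<And>n. \<bar>a n\<bar> \<le> 2"
  shows "kneading a holomorphic_on ball 0 1"
proof -
  have "(\<lambda>z. \<Sum>n. of_real (a n) * z ^ n) holomorphic_on ball (0::complex) 1"
    by (rule power_series_holomorphic[where a = "\<lambda>n. of_real (a n)"])
      (use kneading_summable[OF assms] in \<open>auto intro: summable_sums\<close>)
  then show ?thesis unfolding kneading_def[abs_def] by (intro holomorphic_intros)
qed

text \<open>After n iterations the remainder is at most t^n * L 1 in absolute value, so it
  disappears in the limit.\<close>

lemma kneading_expansion:
  assumes w: "w \<in> Tbar" and t: "0 < t" "t < 1"
    and L: "mono_on {0..1} L" "L 0 = 0"
    and eq: "\<And>x y. third x y \<Longrightarrow> L y - L x = t * \<bar>L (stunted_sawtooth w y) - L (stunted_sawtooth w x)\<bar>"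
    and x: "0 \<le> x" "x \<le> 1"
  shows "of_real (L x) = kneading (top_coeff w x) (of_real t) * of_real (L (fst w))
    + kneading (bot_coeff w x) (of_real t) * of_real (L (snd w))"
proof -
  let ?f = "stunted_sawtooth w"
  let ?a = "L (fst w)" and ?b = "L (snd w)"
  have Lm: "L u \<le> L v" if "0 \<le> u" "u \<le> v" "v \<le> 1" for u v
    using L(1) that unfolding monotone_on_def by auto
  note wb = Tbar_bounds[OF w]
  have a: "L (1/3) = t * ?a"
    using eq[of 0 "1/3"] w L(2) Lm[of 0 "fst w"] wb by (simp add: third_def)
  have b: "L (2/3) = 2 * t * ?a - t * ?b"
    using eq[of "1/3" "2/3"] w a Lm[of "snd w" "fst w"] wb by (simp add: third_def algebra_simps)
  have step: "L y = t * (slope_sign y * L (?f y) + (if y \<le> 1/3 then 0 else 2) * ?a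
      + (if y \<le> 2/3 then 0 else -2) * ?b)" if y: "0 \<le> y" "y \<le> 1" for y
  proof -
    have r: "0 \<le> ?f y" "?f y \<le> 1" using stunted_sawtooth_range[OF w y] by auto
    consider "y \<le> 1/3" | "1/3 < y" "y \<le> 2/3" | "2/3 < y" by linarith
    then show ?thesis
    proof cases
      case 1
      then have "L y = t * L (?f y)"
        using eq[of 0 y] y w L(2) Lm[of 0 "?f y"] r by (simp add: third_def)
      then show ?thesis using 1 by (simp add: slope_sign_def)
    next
      case 2
      then have "?f y \<le> fst w" by (simp add: stunted_sawtooth_def)
      then have "L (?f y) \<le> ?a" using Lm r wb by blast
      then have "L y = t * ?a + t * (?a - L (?f y))"
        using eq[of "1/3" y] 2 w a by (simp add: third_def)
      then show ?thesis using 2 by (simp add: slope_sign_def algebra_simps)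
    next
      case 3
      then have "snd w \<le> ?f y" by (simp add: stunted_sawtooth_def)
      then have "?b \<le> L (?f y)" using Lm r wb by blast
      then have "L y = 2 * t * ?a - t * ?b + t * (L (?f y) - ?b)"
        using eq[of "2/3" y] 3 y w b by (simp add: third_def)
      then show ?thesis using 3 by (simp add: slope_sign_def algebra_simps)
    qed
  qed
  define \<pi> where "\<pi> n = (\<Prod>i<n. slope_sign ((?f ^^ i) x))" for n
  have expand: "L x = (\<Sum>k<n. t ^ Suc k * (top_coeff w x k * ?a + bot_coeff w x k * ?b))
      + t ^ n * \<pi> n * L ((?f ^^ n) x)" for n
  proof (induction n)
    case 0
    then show ?case by (simp add: \<pi>_def)
  next
    case (Suc n)
    let ?y = "(?f ^^ n) x"
    have y: "0 \<le> ?y" "?y \<le> 1" using funpow_stunted_sawtooth_range[OF w x] by auto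
    have "t ^ n * \<pi> n * L ?y = t ^ Suc n * (top_coeff w x n * ?a + bot_coeff w x n * ?b)
        + t ^ Suc n * \<pi> (Suc n) * L ((?f ^^ Suc n) x)"
      unfolding top_coeff_def bot_coeff_def \<pi>_def[symmetric]
      by (subst step[OF y]) (simp add: \<pi>_def algebra_simps)
    with Suc show ?case by simp
  qed
  have "(\<lambda>n. t ^ n * \<pi> n * L ((?f ^^ n) x)) \<longlonglongrightarrow> 0"
  proof (rule Lim_null_comparison)
    show "(\<lambda>n. t ^ n * L 1) \<longlonglongrightarrow> 0"
      using tendsto_mult[OF LIMSEQ_power_zero[of t] tendsto_const[of "L 1"]] t by simp
    have "norm (t ^ n * \<pi> n * L ((?f ^^ n) x)) \<le> t ^ n * L 1" for n
    proof -
      have "0 \<le> (?f ^^ n) x" "(?f ^^ n) x \<le> 1" using funpow_stunted_sawtooth_range[OF w x] by auto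
      then have "\<bar>L ((?f ^^ n) x)\<bar> \<le> L 1" using Lm[of 0 "(?f ^^ n) x"] Lm[of "(?f ^^ n) x" 1] L(2) by simp
      then show ?thesis using t abs_prod_slope_sign[of "\<lambda>i. (?f ^^ i) x" n] \<pi>_def
        by (simp add: abs_mult mult_left_mono)
    qed
    then show "\<forall>\<^sub>F n in sequentially. norm (t ^ n * \<pi> n * L ((?f ^^ n) x)) \<le> t ^ n * L 1" by simp
  qed
  then have "(\<lambda>n. L x - t ^ n * \<pi> n * L ((?f ^^ n) x)) \<longlonglongrightarrow> L x - 0" by (intro tendsto_intros)
  moreover have "L x - t ^ n * \<pi> n * L ((?f ^^ n) x) =
      (\<Sum>k<n. t ^ Suc k * (top_coeff w x k * ?a + bot_coeff w x k * ?b))" for n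
    using expand[of n] by simp
  ultimately have "(\<lambda>k. t ^ Suc k * (top_coeff w x k * ?a + bot_coeff w x k * ?b)) sums L x"
    unfolding sums_def by simp
  then have 1: "(\<lambda>k. of_real (t ^ Suc k * (top_coeff w x k * ?a + bot_coeff w x k * ?b)) :: complex) sums of_real (L x)"
    by (rule sums_of_real)
  let ?z = "complex_of_real t"
  have "norm ?z < 1" using t by simp
  then have "summable (\<lambda>n. of_real (top_coeff w x n) * ?z ^ n)" "summable (\<lambda>n. of_real (bot_coeff w x n) * ?z ^ n)"
    by (intro kneading_summable coeff_bounds; assumption)+
  then have 2: "(\<lambda>n. ?z * (of_real (top_coeff w x n) * ?z ^ n) * of_real ?a + ?z * (of_real (bot_coeff w x n) * ?z ^ n) * of_real ?b)
      sums (kneading (top_coeff w x) ?z * of_real ?a + kneading (bot_coeff w x) ?z * of_real ?b)"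
    unfolding kneading_def by (intro sums_add sums_mult sums_mult2 summable_sums)
  have eq': "(\<lambda>k. of_real (t ^ Suc k * (top_coeff w x k * ?a + bot_coeff w x k * ?b)) :: complex) =
     (\<lambda>n. ?z * (of_real (top_coeff w x n) * ?z ^ n) * of_real ?a + ?z * (of_real (bot_coeff w x n) * ?z ^ n) * of_real ?b)"
    by (simp add: algebra_simps)
  show ?thesis by (rule sums_unique2[OF 1[unfolded eq'] 2])
qed

text \<open>The eigenvalue equation forces the kneading determinant to vanish; as an analytic function with
  value 1 at 0 it cannot vanish on an interval.\<close>

lemma no_eigenvalue_interval:
  fixes \<sigma> s :: real
  assumes w: "w \<in> Tbar" and "1 \<le> \<sigma>" "\<sigma> < s"
    and eigen: "\<And>\<tau>. \<lbrakk>\<sigma> < \<tau>; \<tau> < s\<rbrakk> \<Longrightarrow> \<exists>L. mono_on {0..1} L \<and> L 0 = 0 \<and> L 1 = 1 \<and>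
      (\<forall>x y. third x y \<longrightarrow> L y - L x = 1 / \<tau> * \<bar>L (stunted_sawtooth w y) - L (stunted_sawtooth w x)\<bar>)"
  shows False
proof -
  \<comment> \<open>The determinant of the system that \<open>kneading_expansion\<close> gives at x
    = \<open>fst w\<close> and x = \<open>snd w\<close> for the unknowns L (fst w) and L (snd
    w).\<close>
  define D where "D z = (1 - kneading (top_coeff w (fst w)) z) * (1 - kneading (bot_coeff w (snd w)) z)
    - kneading (bot_coeff w (fst w)) z * kneading (top_coeff w (snd w)) z" for z
  have hol: "D holomorphic_on ball 0 1"
    unfolding D_def by (intro holomorphic_intros kneading_holomorphic coeff_bounds)
  define U where "U = complex_of_real ` {1 / s<..<1 / \<sigma>}"
  have zero: "D z = 0" if z: "z \<in> U" for z
  proof -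
    from z obtain t where t: "z = of_real t" "1 / s < t" "t < 1 / \<sigma>" unfolding U_def by auto
    have s0: "0 < s" "0 < \<sigma>" using assms by auto
    have t0: "0 < t" using t(2) s0 by (meson divide_pos_pos less_trans zero_less_one)
    have t1: "t < 1" using t(3) assms(2) by (smt (verit) divide_le_eq_1)
    have tau: "\<sigma> < 1 / t" "1 / t < s" using t t0 s0 by (auto simp: field_simps)
    obtain L where L: "mono_on {0..1} L" "L 0 = 0" "L 1 = 1" 
      "\<And>x y. third x y \<Longrightarrow> L y - L x = t * \<bar>L (stunted_sawtooth w y) - L (stunted_sawtooth w x)\<bar>"
      using eigen[OF tau] by auto
    let ?a = "L (fst w)" and ?b = "L (snd w)"
    note wb = Tbar_bounds[OF w]
    have K: "of_real (L x) = kneading (top_coeff w x) z * of_real ?a + kneading (bot_coeff w x) z * of_real ?b"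
      if "0 \<le> x" "x \<le> 1" for x
      unfolding t(1) by (rule kneading_expansion[OF w t0 t1 L(1,2,4) that])
    \<comment> \<open>A trivial solution would force L 1 = 0 by the expansion at x = 1.\<close>
    have ne: "?a \<noteq> 0 \<or> ?b \<noteq> 0"
    proof (rule ccontr)
      assume "\<not> (?a \<noteq> 0 \<or> ?b \<noteq> 0)"
      then show False using K[of 1] L(3) by simp
    qed
    have "D z * of_real ?a = 0"
    proof -
      have 1: "(1 - kneading (top_coeff w (fst w)) z) * of_real ?a = kneading (bot_coeff w (fst w)) z * of_real ?b"
        using K[of "fst w"] wb by (simp add: algebra_simps)
      have 2: "(1 - kneading (bot_coeff w (snd w)) z) * of_real ?b = kneading (top_coeff w (snd w)) z * of_real ?a"
        using K[of "snd w"] wb by (simp add: algebra_simps)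
      have "D z * of_real ?a = (1 - kneading (bot_coeff w (snd w)) z) * ((1 - kneading (top_coeff w (fst w)) z) * of_real ?a)
        - kneading (bot_coeff w (fst w)) z * (kneading (top_coeff w (snd w)) z * of_real ?a)"
        unfolding D_def by (simp add: algebra_simps)
      also have "\<dots> = 0" unfolding 1 2[symmetric] by (simp add: algebra_simps)
      finally show ?thesis .
    qed
    moreover have "D z * of_real ?b = 0"
    proof -
      have 1: "(1 - kneading (top_coeff w (fst w)) z) * of_real ?a = kneading (bot_coeff w (fst w)) z * of_real ?b"
        using K[of "fst w"] wb by (simp add: algebra_simps)
      have 2: "(1 - kneading (bot_coeff w (snd w)) z) * of_real ?b = kneading (top_coeff w (snd w)) z * of_real ?a"
        using K[of "snd w"] wb by (simp add: algebra_simps)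
      have "D z * of_real ?b = (1 - kneading (top_coeff w (fst w)) z) * ((1 - kneading (bot_coeff w (snd w)) z) * of_real ?b)
        - kneading (top_coeff w (snd w)) z * (kneading (bot_coeff w (fst w)) z * of_real ?b)"
        unfolding D_def by (simp add: algebra_simps)
      also have "\<dots> = 0" unfolding 2 1[symmetric] by (simp add: algebra_simps)
      finally show ?thesis .
    qed
    ultimately show "D z = 0" using ne by auto
  qed
  \<comment> \<open>Midpoint and a quarter of the length of the interval: the points m + d / (n + 1)
    stay inside it and accumulate at m.\<close>
  define m where "m = (1 / s + 1 / \<sigma>) / 2"
  define d where "d = (1 / \<sigma> - 1 / s) / 4"
  have "1 / s < 1 / \<sigma>" using assms by (simp add: field_simps)
  then have md: "0 < d" "1 / s < m" "m + d < 1 / \<sigma>" unfolding m_def d_def by (simp_all add: field_simps)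
  have sub: "U \<subseteq> ball 0 1"
  proof
    fix z assume "z \<in> U"
    then obtain t where t: "z = of_real t" "1 / s < t" "t < 1 / \<sigma>" unfolding U_def by auto
    have "0 < 1 / s" "1 / \<sigma> \<le> 1" using assms by auto
    then have "0 < t" "t < 1" using t by linarith+
    then show "z \<in> ball 0 1" using t(1) by simp
  qed
  have "complex_of_real m islimpt U"
  proof (unfold islimpt_sequential, intro exI conjI allI)
    let ?g = "\<lambda>n. complex_of_real (m + d * inverse (real (Suc n)))"
    fix n
    have "0 < inverse (real (Suc n))" "inverse (real (Suc n)) \<le> 1" by (auto simp: field_simps)
    then have "0 < d * inverse (real (Suc n))" "d * inverse (real (Suc n)) \<le> d * 1"
      using md(1) by (auto intro: mult_pos_pos mult_left_mono simp del: of_nat_Suc mult_1_right)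
    then have "1 / s < m + d * inverse (real (Suc n))" "m + d * inverse (real (Suc n)) < 1 / \<sigma>"
      "m + d * inverse (real (Suc n)) \<noteq> m" using md by linarith+
    then have "m + d * inverse (real (Suc n)) \<in> {1 / s<..<1 / \<sigma>}" "m + d * inverse (real (Suc n)) \<noteq> m"
      by auto
    then show "?g n \<in> U - {complex_of_real m}"
      unfolding U_def Diff_iff singleton_iff of_real_eq_iff by blast
  next
    have "(\<lambda>n. m + d * inverse (real (Suc n))) \<longlonglongrightarrow> m + d * 0"
      by (intro tendsto_intros LIMSEQ_inverse_real_of_nat)
    then show "(\<lambda>n. complex_of_real (m + d * inverse (real (Suc n)))) \<longlonglongrightarrow> complex_of_real m"
      by (intro tendsto_of_real) simp
  qed
  moreover have "complex_of_real m \<in> ball 0 1"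
  proof -
    have "m \<in> {1 / s<..<1 / \<sigma>}" using md by auto
    then have "complex_of_real m \<in> U" unfolding U_def by (rule imageI)
    with sub show ?thesis by blast
  qed
  ultimately have "D 0 = 0"
    by (intro analytic_continuation[OF hol open_ball connected_ball sub _ _ zero]) auto
  then show False by (simp add: D_def kneading_def)
qed

section \<open>Continuity of the growth rate\<close>

lemma growth_lower_semicontinuous:
  assumes w: "w \<in> Tbar" and W: "\<And>k. W k \<in> Tbar" and lim: "W \<longlonglongrightarrow> w"
    and \<sigma>: "\<And>k. growth (W k) \<le> \<sigma>"
  shows "growth w \<le> \<sigma>"
proof (rule ccontr)
  assume "\<not> growth w \<le> \<sigma>"
  then have less: "\<sigma> < growth w" by simp
  have "1 \<le> \<sigma>" using growth_ge_1[OF W, of 0] \<sigma>[of 0] by simp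
  show False
  proof (rule no_eigenvalue_interval[OF w \<open>1 \<le> \<sigma>\<close> less])
    fix \<tau> assume \<tau>: "\<sigma> < \<tau>" "\<tau> < growth w"
    have \<tau>1: "1 < \<tau>" using \<tau> \<open>1 \<le> \<sigma>\<close> by simp
    \<comment> \<open>Sums bounded along a tail would bound its lap numbers uniformly in k;
      \<open>fvar_crossing_le\<close> passes this bound to w and contradicts \<tau> < growth
      w.\<close>
    have unbounded: "\<exists>k\<ge>i. \<exists>N. real i + 1 \<le> wsum (W k) (1 / \<tau>) N 1" for i
    proof (rule ccontr)
      assume "\<not> (\<exists>k\<ge>i. \<exists>N. real i + 1 \<le> wsum (W k) (1 / \<tau>) N 1)"
      then have bounded: "wsum (W (k + i)) (1 / \<tau>) N 1 \<le> real i + 1" for k N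
        by (metis le_add2 linorder_le_cases)
      obtain \<tau>' where \<tau>': "\<tau> < \<tau>'" "\<tau>' < growth w" using dense[OF \<tau>(2)] by blast
      have "0 < \<tau>" "1 \<le> \<tau>'" "0 \<le> real i + 1" using \<tau>1 \<tau>' by auto
      then obtain B where B: "0 < B" "\<And>n. 1 + real n * (real i + 1) * \<tau> ^ n \<le> B * \<tau>' ^ n"
        using linear_le_exponential[of \<tau> \<tau>' "real i + 1"] \<tau>'(1) by blast
      have "real (laps (stunted_sawtooth (W (k + i)) ^^ n)) \<le> B * \<tau>' ^ n" for k n
      proof -
        have "real (laps (stunted_sawtooth (W (k + i)) ^^ n)) \<le> 1 + real n * (real i + 1) * \<tau> ^ n"
          by (rule laps_le_of_fvar[OF W]) (use \<tau>1 fvar_le_of_wsum[OF W _ bounded] in auto)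
        then show ?thesis using B(2)[of n] by linarith
      qed
      then have "fvar w crossing n 1 \<le> 2 * (B * \<tau>' ^ n)" for n
        by (intro fvar_crossing_le[OF w, of "\<lambda>k. W (k + i)"] W LIMSEQ_ignore_initial_segment lim)
      then have "growth w \<le> \<tau>'"
        by (intro growth_le_of_fvar[OF w \<open>1 \<le> \<tau>'\<close>, of "2 * B"]) (use B(1) in \<open>auto simp: mult.assoc\<close>)
      with \<tau>' show False by simp
    qed
    have "\<exists>k M. k \<ge> i \<and> real i + 1 \<le> wsum (W k) (1 / \<tau>) (Suc M) 1 \<and>
        (1 / \<tau>) ^ M * fvar (W k) crossing M 1 \<le> 1" for i
    proof -
      obtain k N where k: "k \<ge> i" "real i + 1 \<le> wsum (W k) (1 / \<tau>) N 1" using unbounded by blast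
      \<comment> \<open>Still above \<open>growth (W k)\<close>, so v(n) = O(\<tau>'^n) and v(n) /
        \<tau>^n tends to 0.\<close>
      define \<tau>' where "\<tau>' = (\<sigma> + \<tau>) / 2"
      have \<tau>': "growth (W k) < \<tau>'" "\<tau>' < \<tau>" "0 < \<tau>'" using \<tau>(1) \<sigma>[of k] \<open>1 \<le> \<sigma>\<close> by (auto simp: \<tau>'_def)
      obtain B where B: "0 \<le> B" "\<And>n. fvar (W k) crossing n 1 \<le> B * \<tau>' ^ n"
        using fvar_le_of_growth[OF W \<tau>'(1)] by blast
      have q: "0 \<le> \<tau>' / \<tau>" "\<tau>' / \<tau> < 1" using \<tau>' \<tau>1 by auto
      obtain m where m: "(\<tau>' / \<tau>) ^ m < 1 / (B + 1)"
        using real_arch_pow_inv[OF _ q(2), of "1 / (B + 1)"] B(1) by auto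
      \<comment> \<open>M >= N keeps the sum large, M >= m makes the last term at most 1.\<close>
      define M where "M = max N m"
      have "(1 / \<tau>) ^ M * fvar (W k) crossing M 1 \<le> (1 / \<tau>) ^ M * (B * \<tau>' ^ M)"
        using B(2) \<tau>1 by (intro mult_left_mono) auto
      also have "\<dots> = B * (\<tau>' / \<tau>) ^ M" by (simp add: power_divide)
      also have "\<dots> \<le> B * (\<tau>' / \<tau>) ^ m" using q B(1) by (intro mult_left_mono power_decreasing) (auto simp: M_def)
      also have "\<dots> \<le> B * (1 / (B + 1))" using m B(1) by (intro mult_left_mono) auto
      also have "\<dots> \<le> 1" using B(1) by simp
      finally have "(1 / \<tau>) ^ M * fvar (W k) crossing M 1 \<le> 1" .
      moreover have "wsum (W k) (1 / \<tau>) N 1 \<le> wsum (W k) (1 / \<tau>) (Suc M) 1"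
        unfolding wsum_def by (rule sum_mono2) (use \<tau>1 fvar_crossing_nonneg[OF W] in \<open>auto simp: M_def\<close>)
      ultimately show ?thesis using k by (intro exI[of _ k] exI[of _ M]) auto
    qed
    then obtain \<kappa> M where \<kappa>: "\<And>i. \<kappa> i \<ge> i" "\<And>i. real i + 1 \<le> wsum (W (\<kappa> i)) (1 / \<tau>) (Suc (M i)) 1"
      "\<And>i. (1 / \<tau>) ^ M i * fvar (W (\<kappa> i)) crossing (M i) 1 \<le> 1" by metis
    have "filterlim \<kappa> at_top sequentially"
      by (rule filterlim_at_top_mono[OF filterlim_ident]) (use \<kappa>(1) in auto)
    then have lim': "(\<lambda>i. W (\<kappa> i)) \<longlonglongrightarrow> w" by (rule filterlim_compose[OF lim])
    have t: "0 < 1 / \<tau>" "1 / \<tau> < 1" using \<tau>1 by auto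
    obtain L where L: "mono_on {0..1} L" "L 0 = 0" "L 1 = 1"
      "\<And>x y. third x y \<Longrightarrow> L y - L x \<le> 1 / \<tau> * \<bar>L (stunted_sawtooth w y) - L (stunted_sawtooth w x)\<bar>"
      "\<And>x y. third x y \<Longrightarrow> 1 / \<tau> * \<bar>L (stunted_sawtooth w y) - L (stunted_sawtooth w x)\<bar> \<le> L y - L x"
      by (rule normalized_limit[of w "\<lambda>i. W (\<kappa> i)", OF w W lim' t \<kappa>(2)]) (use \<kappa>(3) in blast)
    then show "\<exists>L. mono_on {0..1} L \<and> L 0 = 0 \<and> L 1 = 1 \<and>
      (\<forall>x y. third x y \<longrightarrow> L y - L x = 1 / \<tau> * \<bar>L (stunted_sawtooth w y) - L (stunted_sawtooth w x)\<bar>)"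
      by (intro exI[of _ L]) (blast intro: order.antisym)
  qed
qed

lemma growth_upper_semicontinuous:
  assumes w: "w \<in> Tbar" and W: "\<And>k. W k \<in> Tbar" and lim: "W \<longlonglongrightarrow> w"
    and \<sigma>: "\<And>k. \<sigma> \<le> growth (W k)"
  shows "\<sigma> \<le> growth w"
proof (rule ccontr)
  assume "\<not> \<sigma> \<le> growth w"
  then obtain \<tau> where \<tau>: "growth w < \<tau>" "\<tau> < \<sigma>" using dense[of "growth w" \<sigma>] by auto
  then have "1 < \<tau>" using growth_ge_1[OF w] by simp
  then have "\<exists>N. B < wsum (W k) (1 / \<tau>) N 1" for k B
    using \<tau>(2) \<sigma>[of k] by (intro wsum_unbounded_of_growth[OF W]) auto
  then have "\<tau> ^ n \<le> real (laps (stunted_sawtooth w ^^ n))" for n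
    by (rule laps_ge_power[OF w W lim \<open>1 < \<tau>\<close>])
  then have "\<tau> \<le> growth w" using \<open>1 < \<tau>\<close> by (intro growth_ge) auto
  with \<tau> show False by simp
qed

lemma continuous_on_growth: "continuous_on Tbar growth"
  unfolding continuous_on_sequentially
proof (intro allI ballI impI, elim conjE)
  fix W w assume w: "w \<in> Tbar" and W: "\<forall>n. W n \<in> Tbar" and lim: "W \<longlonglongrightarrow> w"
  show "(growth \<circ> W) \<longlonglongrightarrow> growth w"
  proof (rule order_tendstoI; rule ccontr)
    fix a assume a: "a < growth w" "\<not> (\<forall>\<^sub>F n in sequentially. a < (growth \<circ> W) n)"
    from not_eventually_sequentiallyD[OF this(2)] obtain r :: "nat \<Rightarrow> nat" where r: "strict_mono r" "\<forall>n. growth (W (r n)) \<le> a"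
      by (auto simp: not_less)
    have "growth w \<le> a"
      by (rule growth_lower_semicontinuous[OF w, of "\<lambda>n. W (r n)"])
        (use W r LIMSEQ_subseq_LIMSEQ[OF lim r(1)] in \<open>auto simp: o_def\<close>)
    with a show False by simp
  next
    fix a assume a: "growth w < a" "\<not> (\<forall>\<^sub>F n in sequentially. (growth \<circ> W) n < a)"
    from not_eventually_sequentiallyD[OF this(2)] obtain r :: "nat \<Rightarrow> nat" where r: "strict_mono r" "\<forall>n. a \<le> growth (W (r n))"
      by (auto simp: not_less)
    have "a \<le> growth w"
      by (rule growth_upper_semicontinuous[OF w, of "\<lambda>n. W (r n)"])
        (use W r LIMSEQ_subseq_LIMSEQ[OF lim r(1)] in \<open>auto simp: o_def\<close>)
    with a show False by simp
  qed
qed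

section \<open>Compactness and connectedness of the isentropes\<close>

lemma growth_mono:
  assumes w: "w \<in> Tbar" and w': "w' \<in> Tbar" and le: "fst w \<le> fst w'" "snd w' \<le> snd w"
  shows "growth w \<le> growth w'"
proof (rule dense_ge)
  fix \<tau> assume \<tau>: "growth w' < \<tau>"
  obtain B where B: "0 \<le> B" "\<And>i. fvar w' crossing i 1 \<le> B * \<tau> ^ i"
    using fvar_le_of_growth[OF w' \<tau>] by blast
  show "growth w \<le> \<tau>"
  proof (rule growth_le_of_fvar[OF w _ B(1)])
    show "1 \<le> \<tau>" using growth_ge_1[OF w'] \<tau> by simp
    fix i
    show "fvar w crossing i 1 \<le> B * \<tau> ^ i"
      using fvar_mono_param[OF w w' le mono_crossing, of 0 1 i] w w' B(2)[of i] by simp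
  qed
qed

text \<open>With equal heights the middle branch is flat, so every iterate increases from 0 to 1 and
  crosses each turning point exactly once.\<close>

lemma growth_diagonal:
  assumes w: "w \<in> Tbar" and "fst w = snd w"
  shows "growth w = 1"
proof (rule antisym)
  have "fvar w crossing i 1 = 2" for i
  proof (induction i)
    case (Suc i)
    have "min 1 (1/3) = (1/3::real)" "max (1/3) (min 1 (2/3)) = (2/3::real)" "max 1 (2/3) = (1::real)"
      by auto
    then show ?case using Suc w assms(2) by (simp only: fvar.simps(2) stunted_sawtooth_fixed)
  qed (simp add: crossing_def)
  then show "growth w \<le> 1" by (intro growth_le_of_fvar[OF w, of 1 2]) auto
qed (rule growth_ge_1[OF w])

lemma isentrope_eq: "isentrope h0 = {w \<in> Tbar. growth w = exp h0}"
proof -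
  have "top_entropy (stunted_sawtooth w) = h0 \<longleftrightarrow> growth w = exp h0" if "w \<in> Tbar" for w
  proof -
    have "0 < growth w" using growth_ge_1[OF that] by simp
    then show ?thesis unfolding top_entropy_eq[OF that] by (metis exp_ln ln_exp)
  qed
  then show ?thesis unfolding isentrope_def by blast
qed

lemma compact_Tbar: "compact Tbar"
proof -
  have "Tbar = {w. fst w \<le> 1} \<inter> {w. snd w \<le> fst w} \<inter> {w. 0 \<le> snd w}" by (auto simp: Tbar_def)
  also have "closed \<dots>" by (intro closed_Int closed_Collect_le continuous_intros)
  finally have "closed Tbar" .
  moreover have "Tbar \<subseteq> cbox (0, 0) (1, 1)" by (auto simp: Tbar_def)
  then have "bounded Tbar" using bounded_subset bounded_cbox by blast
  ultimately show ?thesis by (simp add: compact_eq_bounded_closed)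
qed

lemma convex_Tbar: "convex Tbar"
proof -
  have eq: "Tbar = {w. (1, 0) \<bullet> w \<le> 1} \<inter> {w. (-1, 1) \<bullet> w \<le> 0} \<inter> {w. (0, -1) \<bullet> w \<le> 0}"
    by (auto simp: Tbar_def inner_Pair)
  show ?thesis unfolding eq by (intro convex_Int convex_halfspace_le)
qed

lemma compact_isentrope: "compact (isentrope h0)"
proof -
  have "closedin (top_of_set Tbar) {w \<in> Tbar. growth w = exp h0}"
    by (rule continuous_closedin_preimage_constant[OF continuous_on_growth])
  then show ?thesis unfolding isentrope_eq using compact_Tbar closedin_compact by blast
qed

text \<open>On the lines \<open>fst w + snd w = c\<close> the growth rate is monotone, so the isentrope meets each of
  them in a segment; these lines meet it exactly when the growth rate at their endpoint on the
  boundary is large enough.\<close>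

lemma convex_isentrope_line: "convex (isentrope h0 \<inter> {w. fst w + snd w = c})"
proof -
  have *: "(1 - u) *\<^sub>R w + u *\<^sub>R w' \<in> isentrope h0 \<inter> {w. fst w + snd w = c}"
    if w: "w \<in> isentrope h0" "fst w + snd w = c" and w': "w' \<in> isentrope h0" "fst w' + snd w' = c"
      and u: "0 \<le> u" "u \<le> 1" and le: "fst w \<le> fst w'" for w w' u
  proof -
    let ?v = "(1 - u) *\<^sub>R w + u *\<^sub>R w'"
    have T: "w \<in> Tbar" "w' \<in> Tbar" "growth w = exp h0" "growth w' = exp h0" using w w' by (auto simp: isentrope_eq)
    then have v: "?v \<in> Tbar" using convex_Tbar u unfolding convex_alt by blast
    define X where "X = u * (fst w' - fst w)"
    have d: "snd w' - snd w = - (fst w' - fst w)" using w w' by linarith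
    have f1: "fst ?v = fst w + X" by (simp add: X_def algebra_simps)
    have "snd ?v = snd w + u * (snd w' - snd w)" by (simp add: algebra_simps)
    then have f2: "snd ?v = snd w - X" unfolding d X_def by (simp only: mult_minus_right add_uminus_conv_diff)
    have X: "0 \<le> X" "X \<le> fst w' - fst w"
      using u le mult_right_mono[OF u(2), of "fst w' - fst w"] by (auto simp: X_def)
    have "fst w \<le> fst ?v" "fst ?v \<le> fst w'" "snd ?v \<le> snd w" "snd w' \<le> snd ?v"
      unfolding f1 f2 using X d by linarith+
    then have "growth ?v = exp h0"
      using growth_mono[OF T(1) v] growth_mono[OF v T(2)] T by auto
    moreover have "fst ?v + snd ?v = c" unfolding f1 f2 using w(2) by linarith
    ultimately show ?thesis using v by (simp add: isentrope_eq)
  qed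
  show ?thesis
    unfolding convex_alt
  proof (intro ballI allI impI)
    fix w w' and u :: real
    assume a: "w \<in> isentrope h0 \<inter> {w. fst w + snd w = c}" "w' \<in> isentrope h0 \<inter> {w. fst w + snd w = c}"
      "0 \<le> u \<and> u \<le> 1"
    show "(1 - u) *\<^sub>R w + u *\<^sub>R w' \<in> isentrope h0 \<inter> {w. fst w + snd w = c}"
    proof (cases "fst w \<le> fst w'")
      case False
      then show ?thesis using *[of w' w "1 - u"] a by (simp add: add.commute)
    qed (use * a in auto)
  qed
qed

lemma interval_isentrope_lines:
  assumes "0 \<le> h0"
  shows "is_interval ((\<lambda>w. fst w + snd w) ` isentrope h0)"
  unfolding is_interval_1
proof (intro ballI allI impI, elim imageE)
  fix a b c z1 z2
  assume a: "a = fst z1 + snd z1" "z1 \<in> isentrope h0" and b: "b = fst z2 + snd z2" "z2 \<in> isentrope h0"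
    and c: "a \<le> c \<and> c \<le> b"
  have z1: "z1 \<in> Tbar" "growth z1 = exp h0" and z2: "z2 \<in> Tbar" "growth z2 = exp h0"
    using a b by (auto simp: isentrope_eq)
  note b1 = Tbar_bounds[OF z1(1)] and b2 = Tbar_bounds[OF z2(1)]
  \<comment> \<open>The largest point of the line in the order of \<open>growth_mono\<close>. It
    rises with c up to c = 1 and falls afterwards, so it dominates z1 in the first case and z2 in
    the second.\<close>
  define e where "e = (if c \<le> 1 then (c, 0) else (1, c - 1))"
  have c2: "0 \<le> c" "c \<le> 2" using a b c b1 b2 by auto
  have e: "e \<in> Tbar" "fst e + snd e = c" using c2 by (auto simp: e_def Tbar_def)
  have d: "(c / 2, c / 2) \<in> Tbar" using c2 by (auto simp: Tbar_def)
  have "exp h0 \<le> growth e"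
  proof (cases "c \<le> 1")
    case True
    have "growth z1 \<le> growth e"
      by (rule growth_mono[OF z1(1) e(1)]) (use True a b1 c in \<open>auto simp: e_def\<close>)
    with z1 show ?thesis by simp
  next
    case False
    have "growth z2 \<le> growth e"
      by (rule growth_mono[OF z2(1) e(1)]) (use False b b2 c in \<open>auto simp: e_def\<close>)
    with z2 show ?thesis by simp
  qed
  \<comment> \<open>Along this segment the growth rate runs from 1 on the diagonal to at least exp
    h0 at e; 0 <= h0 puts exp h0 in between.\<close>
  define \<gamma> where "\<gamma> u = (1 - u) *\<^sub>R (c / 2, c / 2) + u *\<^sub>R e" for u
  have \<gamma>: "\<gamma> u \<in> Tbar" if "u \<in> {0..1}" for u
    using convex_Tbar d e(1) that unfolding convex_alt \<gamma>_def by auto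
  have "continuous_on {0..1} (growth \<circ> \<gamma>)"
    by (rule continuous_on_compose)
      (auto simp: \<gamma>_def[abs_def] intro!: continuous_intros intro: continuous_on_subset[OF continuous_on_growth]
        dest!: \<gamma>[unfolded \<gamma>_def])
  moreover have "(growth \<circ> \<gamma>) 0 \<le> exp h0" using growth_diagonal[OF d] assms by (simp add: \<gamma>_def)
  moreover have "exp h0 \<le> (growth \<circ> \<gamma>) 1" using \<open>exp h0 \<le> growth e\<close> by (simp add: \<gamma>_def flip: zero_prod_def)
  ultimately obtain u where u: "0 \<le> u" "u \<le> 1" "growth (\<gamma> u) = exp h0"
    using IVT'[of "growth \<circ> \<gamma>" 0 "exp h0" 1] by auto
  have "fst (\<gamma> u) + snd (\<gamma> u) = (1 - u) * c + u * (fst e + snd e)"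
    unfolding \<gamma>_def by (simp add: algebra_simps)
  also have "\<dots> = c" using e(2) by (simp add: algebra_simps)
  finally have "c = fst (\<gamma> u) + snd (\<gamma> u)" ..
  moreover have "\<gamma> u \<in> isentrope h0" using u \<gamma>[of u] by (simp add: isentrope_eq)
  ultimately show "c \<in> (\<lambda>w. fst w + snd w) ` isentrope h0" by (rule image_eqI)
qed

text \<open>On a compact set the projection to c is a closed map; with connected fibres and
  connected image, connectedness lifts to the domain.\<close>

lemma connected_isentrope:
  assumes "0 \<le> h0"
  shows "connected (isentrope h0)"
proof -
  let ?p = "\<lambda>w :: real \<times> real. fst w + snd w"
  let ?Z = "isentrope h0"
  have "connected (?Z \<inter> ?p -` (?p ` ?Z))"
  proof (rule connected_closed_monotone_preimage)
    show cont: "continuous_on ?Z ?p" by (intro continuous_intros)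
    show "closedin (top_of_set (?p ` ?Z)) (?p ` C)" if C: "closedin (top_of_set ?Z) C" for C
    proof -
      have "compact C" using C compact_isentrope closedin_compact by blast
      moreover have sub: "C \<subseteq> ?Z" using C closedin_imp_subset by blast
      ultimately have "compact (?p ` C)"
        using compact_continuous_image continuous_on_subset[OF cont] by blast
      then show ?thesis using sub by (auto intro: closed_subset compact_imp_closed)
    qed
    show "connected (?Z \<inter> ?p -` {y})" for y
      using convex_connected[OF convex_isentrope_line[of h0 y]] by (simp add: vimage_def)
    show "connected (?p ` ?Z)" using interval_isentrope_lines[OF assms] by (simp add: is_interval_connected_1)
  qed auto
  moreover have "?Z \<inter> ?p -` (?p ` ?Z) = ?Z" by blast
  ultimately show ?thesis by simp
qed

theorem theorem1:
  fixes h0 :: real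
  assumes "0 \<le> h0" and "h0 \<le> ln 3"
  shows "compact (isentrope h0) \<and> connected (isentrope h0)"
  using compact_isentrope connected_isentrope[OF assms(1)] by blast

end
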